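(* Let $A=(a_{i,j})_{1\le i,j\le n}$ be an $n\times n$ matrix with complex entries, and let $\lambda\vdash r$ be an integer partition such that $|\lambda^{\ast}|=n$, where $\lambda^{\ast}=(\lambda_2,\lambda_3,\ldots)$ is the partition obtained from $\lambda$ by removing its first row. Then $$\mathrm{Rec}^{\lambda}(A)=\mathrm{Imm}^{\lambda^{\ast}}(A),$$ where $\mathrm{Rec}^{\lambda}$ is the recombinant associated with the irreducible character $\chi^{\lambda}_{P_n(r)}$ of the partition algebra $P_n(r)$, and $\mathrm{Imm}^{\lambda^{\ast}}$ is the immanant associated with the irreducible character $\chi^{\lambda^{\ast}}_{S_n}$ of the symmetric group $S_n$.
   Context: Throughout, $n$ and $r$ are positive integers. **Partition diagrams and the partition algebra.** A partition diagram of order $n$ is a set partition $d$ of the $2n$-element set $\{1,\ldots,n,1',\ldots,n'\}$; the unprimed elements are the upper vertices, the primed elements are the lower vertices, and the blocks of $d$ are called its components. A component is propagating if it contains at least one upper vertex and at least one lower vertex; the propagation number of $d$ is the number of its propagating components. The partition algebra $P_n(r)$ is the $\mathbb{C}$-vector space with basis the set of all partition diagrams of order $n$, with bilinear multiplication given on diagrams as follows: place $d_1$ above $d_2$, identify the lower vertex $i'$ of $d_1$ with the upper vertex $i$ of $d_2$ for each $i$, let $c$ be the number of connected components of the resulting graph lying entirely in the middle row, and set $d_1d_2=r^{c}d$, where $d$ is the diagram obtained by restricting connectivity to the top and bottom rows. **Irreducible characters of $P_n(r)$.** Let $V=\mathbb{C}^r$ with standard basis $v_1,\ldots,v_r$,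 on which $S_r$ acts by permuting basis vectors, and let $S_r$ act diagonally on $V^{\otimes n}$. The algebra $P_n(r)$ acts on $V^{\otimes n}$ by $$d\cdot (v_{j_{1'}}\otimes\cdots\otimes v_{j_{n'}})=\sum_{j_1,\ldots,j_n=1}^{r}\delta_d(j)\, v_{j_1}\otimes\cdots\otimes v_{j_n},$$ where $\delta_d(j)=1$ if $j_a=j_b$ whenever $a,b\in\{1,\ldots,n,1',\ldots,n'\}$ lie in the same component of $d$, and $\delta_d(j)=0$ otherwise. This action commutes with that of $S_r$, and $P_n(r)$ maps onto the centralizer algebra $\mathrm{End}_{S_r}(V^{\otimes n})$. By double centralizer theory, the resulting irreducible representations of $P_n(r)$ are indexed by $$\widehat{P_n(r)}=\{\lambda\vdash r : |\lambda^{\ast}|\le n\},$$ where $\lambda^{\ast}=(\lambda_2,\lambda_3,\ldots)$ and $|\lambda^{\ast}|$ is the sum of its parts: the irreducible $P_n(r)$-module $M^{\lambda}$ is the multiplicity space of the irreducible $S_r$-module $S^{\lambda}$ in $V^{\otimes n}$, i.e. $V^{\otimes n}\cong\bigoplus_{\lambda\in\widehat{P_n(r)}} S^{\lambda}\otimes M^{\lambda}$ as a module for the commuting actions of $S_r$ and $P_n(r)$. Let $\chi^{\lambda}_{P_n(r)}$ denote the character (trace function) of $M^{\lambda}$. **Product associated with a diagram.** For an $n\times n$ matrix $A=(a_{i,j})$ and a partition diagram $d$ of order $n$, define $\prod_d a_{i,j}$ as follows. If $d$ has propagation number $0$, then $\prod_d a_{i,j}=0$. Otherwise, $$\prod_d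 a_{i,j}=\prod_{B}\ \prod_{\substack{i,j\in\{1,\ldots,n\}\\ i\in B,\ j'\in B}} a_{i,j},$$ where $B$ ranges over all propagating components of $d$. **Recombinant.** For $\lambda\in\widehat{P_n(r)}$, the recombinant of the $n\times n$ matrix $A$ is $$\mathrm{Rec}^{\lambda}(A)=\sum_{d}\chi^{\lambda}_{P_n(r)}(d)\prod_d a_{i,j},$$ the sum being over all partition diagrams $d$ of order $n$. **Immanant.** For $\mu\vdash n$, let $\chi^{\mu}_{S_n}$ be the irreducible character of $S_n$ indexed by $\mu$ (with $(n)$ giving the trivial character and $(1^n)$ the sign character). Then $$\mathrm{Imm}^{\mu}(A)=\sum_{\sigma\in S_n}\chi^{\mu}_{S_n}(\sigma)\prod_{i=1}^{n}a_{i,\sigma(i)}.$$ *)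

theory Defs
  imports
    "HOL-Library.Function_Algebras"
    "HOL-Library.Disjoint_Sets"
    "HOL-Combinatorics.Permutations"
    "Jordan_Normal_Form.Matrix"
begin

section \<open>Linear algebra in spaces of functions\<close>

definition fscale :: "complex \<Rightarrow> ('a \<Rightarrow> complex) \<Rightarrow> 'a \<Rightarrow> complex" where
  "fscale c f = (\<lambda>x. c * f x)"

definition hscale :: "complex \<Rightarrow> ('b \<Rightarrow> 'a \<Rightarrow> complex) \<Rightarrow> 'b \<Rightarrow> 'a \<Rightarrow> complex" where
  "hscale c \<phi> = (\<lambda>v. fscale c (\<phi> v))"

text \<open>The trace of a linear endomorphism \<open>f\<close> of a finite-dimensional subspace \<open>U\<close>, computed in
  some basis of \<open>U\<close>.\<close>

definition (in vector_space) trace_on :: "'b set \<Rightarrow> ('b \<Rightarrow> 'b) \<Rightarrow> 'a" where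
  "trace_on U f =
     (let B = (SOME B. independent B \<and> span B = U) in \<Sum>b\<in>B. representation B (f b) b)"

interpretation fun_vs: vector_space "fscale :: complex \<Rightarrow> ('a \<Rightarrow> complex) \<Rightarrow> 'a \<Rightarrow> complex"
  by unfold_locales (auto simp: fscale_def fun_eq_iff algebra_simps)

interpretation hom_vs: vector_space
  "hscale :: complex \<Rightarrow> ('b \<Rightarrow> 'a \<Rightarrow> complex) \<Rightarrow> 'b \<Rightarrow> 'a \<Rightarrow> complex"
  by unfold_locales (auto simp: hscale_def fscale_def fun_eq_iff algebra_simps)


section \<open>Irreducible characters of the symmetric group\<close>

text \<open>The symmetric group \<open>S\<^sub>m\<close> consists of the permutations of \<open>{..<m}\<close>. Throughout, indices and
  vertices are numbered from \<open>0\<close>.\<close>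

definition partition_of :: "nat \<Rightarrow> nat list \<Rightarrow> bool" where
  "partition_of m lam \<longleftrightarrow> sorted_wrt (\<ge>) lam \<and> (\<forall>k\<in>set lam. k > 0) \<and> sum_list lam = m"

definition cells :: "nat list \<Rightarrow> (nat \<times> nat) set" where
  "cells lam = {(i, j). i < length lam \<and> j < lam ! i}"

type_synonym tableau = "nat \<times> nat \<Rightarrow> nat"

text \<open>Only the values on \<open>cells lam\<close> of a tableau of shape \<open>lam\<close> are relevant.\<close>

definition tableau_of :: "nat list \<Rightarrow> tableau \<Rightarrow> bool" where
  "tableau_of lam t \<longleftrightarrow> bij_betw t (cells lam) {..<sum_list lam}"

text \<open>A tabloid, i.e.\ a row equivalence class of tableaux, is given by its sequence of rows, each
  row being a set of entries.\<close>

type_synonym tabloid = "nat \<Rightarrow> nat set"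

definition tabloid :: "nat list \<Rightarrow> tableau \<Rightarrow> tabloid" where
  "tabloid lam t = (\<lambda>i. t ` {c \<in> cells lam. fst c = i})"

definition col_stabilizer :: "nat list \<Rightarrow> tableau \<Rightarrow> (nat \<Rightarrow> nat) set" where
  "col_stabilizer lam t = {q. q permutes {..<sum_list lam} \<and>
     (\<forall>j. q ` t ` {c \<in> cells lam. snd c = j} = t ` {c \<in> cells lam. snd c = j})}"

definition polytabloid :: "nat list \<Rightarrow> tableau \<Rightarrow> tabloid \<Rightarrow> complex" where
  "polytabloid lam t =
     (\<lambda>\<tau>. \<Sum>q\<in>col_stabilizer lam t. of_int (sign q) * of_bool (\<tau> = tabloid lam (q \<circ> t)))"

definition specht :: "nat list \<Rightarrow> (tabloid \<Rightarrow> complex) set" where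
  "specht lam = fun_vs.span {polytabloid lam t | t. tableau_of lam t}"

text \<open>The linear extension of \<open>\<sigma> \<cdot> {t} = {\<sigma> \<circ> t}\<close>.\<close>

definition tabloid_act :: "(nat \<Rightarrow> nat) \<Rightarrow> (tabloid \<Rightarrow> complex) \<Rightarrow> tabloid \<Rightarrow> complex" where
  "tabloid_act \<sigma> f = (\<lambda>\<tau>. f (\<lambda>i. Hilbert_Choice.inv \<sigma> ` \<tau> i))"

definition sym_char :: "nat list \<Rightarrow> (nat \<Rightarrow> nat) \<Rightarrow> complex" where
  "sym_char lam \<sigma> = fun_vs.trace_on (specht lam) (tabloid_act \<sigma>)"


section \<open>The partition algebra\<close>

text \<open>In a diagram of order \<open>n\<close> the upper vertices are \<open>Inl i\<close> and the lower ones \<open>Inr i\<close>, \<open>i < n\<close>.\<close>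

type_synonym diagram = "(nat + nat) set set"

definition diagrams :: "nat \<Rightarrow> diagram set" where
  "diagrams n = {d. partition_on ({..<n} <+> {..<n}) d}"

definition propagating :: "diagram \<Rightarrow> (nat + nat) set set" where
  "propagating d = {B \<in> d. (\<exists>i. Inl i \<in> B) \<and> (\<exists>j. Inr j \<in> B)}"

definition propagation_number :: "diagram \<Rightarrow> nat" where
  "propagation_number d = card (propagating d)"

text \<open>For \<open>d\<^sub>1\<close> placed above \<open>d\<^sub>2\<close>, the vertices of the top, middle and bottom row are
  \<open>Inl i\<close>, \<open>Inr (Inl i)\<close> and \<open>Inr (Inr i)\<close>. Every vertex carries a loop, so the transitive closure
  of \<open>stack d\<^sub>1 d\<^sub>2\<close> is the equivalence relation of lying in the same connected component.\<close>

definition three_rows :: "nat \<Rightarrow> (nat + nat + nat) set" where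
  "three_rows n = {..<n} <+> ({..<n} <+> {..<n})"

definition stack :: "diagram \<Rightarrow> diagram \<Rightarrow> (nat + nat + nat) rel" where
  "stack d1 d2 = {(u, v). \<exists>B \<in> (`) (map_sum id Inl) ` d1 \<union> (`) Inr ` d2. u \<in> B \<and> v \<in> B}"

definition stack_comps :: "nat \<Rightarrow> diagram \<Rightarrow> diagram \<Rightarrow> (nat + nat + nat) set set" where
  "stack_comps n d1 d2 = three_rows n // (stack d1 d2)\<^sup>+"

definition middle_comps :: "nat \<Rightarrow> diagram \<Rightarrow> diagram \<Rightarrow> (nat + nat + nat) set set" where
  "middle_comps n d1 d2 = {C \<in> stack_comps n d1 d2. C \<subseteq> range (Inr \<circ> Inl)}"

definition diagram_comp :: "nat \<Rightarrow> diagram \<Rightarrow> diagram \<Rightarrow> diagram" where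
  "diagram_comp n d1 d2 = (vimage (map_sum id Inr)) ` stack_comps n d1 d2 - {{}}"

text \<open>Elements of \<open>P\<^sub>n(r)\<close> are given by their coefficients with respect to the basis of diagrams.\<close>

definition partition_algebra :: "nat \<Rightarrow> (diagram \<Rightarrow> complex) set" where
  "partition_algebra n = {x. \<forall>d. d \<notin> diagrams n \<longrightarrow> x d = 0}"

definition diagram_elt :: "diagram \<Rightarrow> diagram \<Rightarrow> complex" where
  "diagram_elt d = (\<lambda>d'. of_bool (d' = d))"

definition pa_mult ::
  "nat \<Rightarrow> nat \<Rightarrow> (diagram \<Rightarrow> complex) \<Rightarrow> (diagram \<Rightarrow> complex) \<Rightarrow> diagram \<Rightarrow> complex" where
  "pa_mult n r x y = (\<lambda>d. \<Sum>d1\<in>diagrams n. \<Sum>d2\<in>diagrams n.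
     x d1 * y d2 * of_nat r ^ card (middle_comps n d1 d2) * diagram_elt (diagram_comp n d1 d2) d)"


section \<open>The actions on tensor space\<close>

text \<open>The tensor \<open>\<Sum>\<^sub>j w(j) v\<^bsub>j\<^sub>0\<^esub> \<otimes> \<dots> \<otimes> v\<^bsub>j\<^sub>n\<^sub>-\<^sub>1\<^esub>\<close> of the \<open>n\<close>-th tensor power of \<open>\<complex>\<^sup>r\<close> is given by its
  coefficient function \<open>w\<close> on multi-indices \<open>j\<close>.\<close>

definition multi_indices :: "nat \<Rightarrow> nat \<Rightarrow> nat list set" where
  "multi_indices n r = {js. set js \<subseteq> {..<r} \<and> length js = n}"

definition tensor_space :: "nat \<Rightarrow> nat \<Rightarrow> (nat list \<Rightarrow> complex) set" where
  "tensor_space n r = {w. \<forall>js. js \<notin> multi_indices n r \<longrightarrow> w js = 0}"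

definition tensor_act :: "(nat \<Rightarrow> nat) \<Rightarrow> (nat list \<Rightarrow> complex) \<Rightarrow> nat list \<Rightarrow> complex" where
  "tensor_act \<sigma> w = (\<lambda>js. w (map (Hilbert_Choice.inv \<sigma>) js))"

definition delta :: "diagram \<Rightarrow> nat list \<Rightarrow> nat list \<Rightarrow> bool" where
  "delta d js ks \<longleftrightarrow>
     (\<forall>B\<in>d. \<forall>a\<in>B. \<forall>b\<in>B. case_sum ((!) js) ((!) ks) a = case_sum ((!) js) ((!) ks) b)"

definition diagram_act ::
  "nat \<Rightarrow> nat \<Rightarrow> diagram \<Rightarrow> (nat list \<Rightarrow> complex) \<Rightarrow> nat list \<Rightarrow> complex" where
  "diagram_act n r d w = (\<lambda>js. if js \<in> multi_indices n r
     then \<Sum>ks\<in>multi_indices n r. of_bool (delta d js ks) * w ks else 0)"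

definition pa_act ::
  "nat \<Rightarrow> nat \<Rightarrow> (diagram \<Rightarrow> complex) \<Rightarrow> (nat list \<Rightarrow> complex) \<Rightarrow> nat list \<Rightarrow> complex" where
  "pa_act n r x w = (\<lambda>js. \<Sum>d\<in>diagrams n. x d * diagram_act n r d w js)"


section \<open>Irreducible characters of the partition algebra\<close>

text \<open>The multiplicity space of the Specht module \<open>S\<^bsup>lam\<^esup>\<close> in tensor space is the space of
  \<open>S\<^sub>r\<close>-homomorphisms from the former to the latter, on which \<open>P\<^sub>n(r)\<close> acts by postcomposition.
  Homomorphisms are extended by \<open>0\<close> outside the Specht module.\<close>

definition mult_space ::
  "nat \<Rightarrow> nat \<Rightarrow> nat list \<Rightarrow> ((tabloid \<Rightarrow> complex) \<Rightarrow> nat list \<Rightarrow> complex) set" where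
  "mult_space n r lam = {\<phi>.
     (\<forall>v. v \<notin> specht lam \<longrightarrow> \<phi> v = 0) \<and>
     (\<forall>v\<in>specht lam. \<phi> v \<in> tensor_space n r) \<and>
     (\<forall>v\<in>specht lam. \<forall>w\<in>specht lam. \<phi> (v + w) = \<phi> v + \<phi> w) \<and>
     (\<forall>c. \<forall>v\<in>specht lam. \<phi> (fscale c v) = fscale c (\<phi> v)) \<and>
     (\<forall>\<sigma>. \<sigma> permutes {..<r} \<longrightarrow>
        (\<forall>v\<in>specht lam. \<phi> (tabloid_act \<sigma> v) = tensor_act \<sigma> (\<phi> v)))}"

definition pa_char :: "nat \<Rightarrow> nat \<Rightarrow> nat list \<Rightarrow> (diagram \<Rightarrow> complex) \<Rightarrow> complex" where
  "pa_char n r lam x = hom_vs.trace_on (mult_space n r lam) (\<lambda>\<phi> v. pa_act n r x (\<phi> v))"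


section \<open>Recombinants and immanants\<close>

definition diagram_prod :: "complex mat \<Rightarrow> diagram \<Rightarrow> complex" where
  "diagram_prod A d = (if propagation_number d = 0 then 0
     else \<Prod>B\<in>propagating d. \<Prod>(i, j)\<in>{(i, j). Inl i \<in> B \<and> Inr j \<in> B}. A $$ (i, j))"

definition recombinant :: "nat \<Rightarrow> nat \<Rightarrow> nat list \<Rightarrow> complex mat \<Rightarrow> complex" where
  "recombinant n r lam A =
     (\<Sum>d\<in>diagrams n. pa_char n r lam (diagram_elt d) * diagram_prod A d)"

definition immanant :: "nat \<Rightarrow> nat list \<Rightarrow> complex mat \<Rightarrow> complex" where
  "immanant n mu A =
     (\<Sum>\<sigma> | \<sigma> permutes {..<n}. sym_char mu \<sigma> * (\<Prod>i<n. A $$ (i, \<sigma> i)))"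


section \<open>Tensor space and the multiplicity spaces are modules over the partition algebra\<close>

lemma finite_diagrams: "finite (diagrams n)"
proof (rule finite_subset)
  show "diagrams n \<subseteq> Pow (Pow ({..<n} <+> {..<n}))"
    unfolding diagrams_def partition_on_def by blast
qed simp

lemma finite_multi_indices: "finite (multi_indices n r)"
  unfolding multi_indices_def by (rule finite_lists_length_eq) simp

lemma equiv_stack:
  assumes "d1 \<in> diagrams n" "d2 \<in> diagrams n"
  shows "equiv (three_rows n) ((stack d1 d2)\<^sup>+)"
proof (rule equivI)
  have U1: "\<Union>d1 = {..<n} <+> {..<n}" and U2: "\<Union>d2 = {..<n} <+> {..<n}"
    using assms by (auto simp: diagrams_def partition_on_def)
  have field: "stack d1 d2 \<subseteq> three_rows n \<times> three_rows n"
  proof (clarify, intro conjI)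
    fix u v assume "(u, v) \<in> stack d1 d2"
    moreover have "map_sum id Inl a \<in> three_rows n" if "a \<in> B" "B \<in> d1" for a B
    proof -
      have "a \<in> {..<n} <+> {..<n}" using that U1 by blast
      then show ?thesis by (auto simp: three_rows_def)
    qed
    moreover have "Inr a \<in> three_rows n" if "a \<in> B" "B \<in> d2" for a B
    proof -
      have "a \<in> {..<n} <+> {..<n}" using that U2 by blast
      then show ?thesis by (auto simp: three_rows_def)
    qed
    ultimately have "u \<in> three_rows n \<and> v \<in> three_rows n" by (auto simp: stack_def)
    then show "u \<in> three_rows n" "v \<in> three_rows n" by auto
  qed
  then show "(stack d1 d2)\<^sup>+ \<subseteq> three_rows n \<times> three_rows n"
    by (rule trancl_subset_Sigma)
  have "(v, v) \<in> stack d1 d2" if "v \<in> three_rows n" for v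
  proof -
    have v: "(\<exists>i<n. v = Inl i) \<or> (\<exists>i<n. v = Inr (Inl i)) \<or> (\<exists>i<n. v = Inr (Inr i))"
      using that by (auto simp: three_rows_def)
    then consider a where "v = map_sum id Inl a" "a \<in> {..<n} <+> {..<n}"
      | a where "v = Inr a" "a \<in> {..<n} <+> {..<n}"
      by (metis InlI InrI lessThan_iff map_sum.simps(1) id_apply)
    then show ?thesis
    proof cases
      case 1
      with U1 obtain B where "B \<in> d1" "a \<in> B" by blast
      with 1 show ?thesis unfolding stack_def by blast
    next
      case 2
      with U2 obtain B where "B \<in> d2" "a \<in> B" by blast
      with 2 show ?thesis unfolding stack_def by blast
    qed
  qed
  then show "refl_on (three_rows n) ((stack d1 d2)\<^sup>+)"
    by (auto simp: refl_on_def)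
  show "sym ((stack d1 d2)\<^sup>+)"
    by (rule sym_trancl) (auto simp: sym_def stack_def)
  show "trans ((stack d1 d2)\<^sup>+)" by (rule trans_trancl)
qed

lemma diagram_comp_in_diagrams:
  assumes "d1 \<in> diagrams n" "d2 \<in> diagrams n"
  shows "diagram_comp n d1 d2 \<in> diagrams n"
proof -
  have P: "partition_on (three_rows n) (stack_comps n d1 d2)"
    unfolding stack_comps_def by (rule partition_on_quotient[OF equiv_stack[OF assms]])
  have vim: "map_sum id Inr -` three_rows n = {..<n} <+> {..<n}"
  proof -
    have "map_sum id Inr x \<in> three_rows n \<longleftrightarrow> x \<in> {..<n} <+> {..<n}" for x :: "nat + nat"
      by (cases x) (auto simp: three_rows_def)
    then show ?thesis by blast
  qed
  show ?thesis unfolding diagrams_def mem_Collect_eq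
  proof (rule partition_onI)
    show "\<Union>(diagram_comp n d1 d2) = {..<n} <+> {..<n}"
    proof -
      have "\<Union>(diagram_comp n d1 d2) = map_sum id Inr -` \<Union>(stack_comps n d1 d2)"
        by (auto simp: diagram_comp_def)
      then show ?thesis using partition_onD1[OF P] vim by simp
    qed
    fix p q assume "p \<in> diagram_comp n d1 d2" "q \<in> diagram_comp n d1 d2" "p \<noteq> q"
    then obtain C D where "C \<in> stack_comps n d1 d2" "D \<in> stack_comps n d1 d2" "C \<noteq> D"
      "p = map_sum id Inr -` C" "q = map_sum id Inr -` D" unfolding diagram_comp_def by blast
    moreover from this have "C \<inter> D = {}" using partition_onD2[OF P] by (simp add: disjoint_def)
    ultimately show "disjnt p q" by (auto simp: disjnt_def)
  qed (auto simp: diagram_comp_def)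
qed

lemma pa_mult_closed: "pa_mult n r x y \<in> partition_algebra n"
proof -
  have "pa_mult n r x y d = 0" if "d \<notin> diagrams n" for d
    unfolding pa_mult_def using that diagram_comp_in_diagrams
    by (intro sum.neutral ballI) (auto simp: diagram_elt_def)
  then show ?thesis by (auto simp: partition_algebra_def)
qed

definition lab3 :: "nat list \<Rightarrow> nat list \<Rightarrow> nat list \<Rightarrow> nat + nat + nat \<Rightarrow> nat" where
  "lab3 js ms ks = case_sum ((!) js) (case_sum ((!) ms) ((!) ks))"

lemma delta_stack:
  "delta d1 js ms \<and> delta d2 ms ks \<longleftrightarrow>
     (\<forall>(u, v)\<in>(stack d1 d2)\<^sup>+. lab3 js ms ks u = lab3 js ms ks v)"
proof -
  have 1: "lab3 js ms ks (map_sum id Inl a) = case_sum ((!) js) ((!) ms) a" for a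
    by (cases a) (auto simp: lab3_def)
  have 2: "lab3 js ms ks (Inr a) = case_sum ((!) ms) ((!) ks) a" for a
    by (auto simp: lab3_def)
  have "delta d1 js ms \<and> delta d2 ms ks \<longleftrightarrow>
     (\<forall>(u, v)\<in>stack d1 d2. lab3 js ms ks u = lab3 js ms ks v)"
  proof -
    have "delta d1 js ms \<longleftrightarrow> (\<forall>B\<in>(`) (map_sum id Inl) ` d1. \<forall>u\<in>B. \<forall>v\<in>B. lab3 js ms ks u = lab3 js ms ks v)"
      by (simp add: delta_def 1)
    moreover have "delta d2 ms ks \<longleftrightarrow> (\<forall>B\<in>(`) Inr ` d2. \<forall>u\<in>B. \<forall>v\<in>B. lab3 js ms ks u = lab3 js ms ks v)"
      by (simp add: delta_def 2)
    ultimately have "delta d1 js ms \<and> delta d2 ms ks \<longleftrightarrow>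
      (\<forall>B\<in>(`) (map_sum id Inl) ` d1 \<union> (`) Inr ` d2. \<forall>u\<in>B. \<forall>v\<in>B. lab3 js ms ks u = lab3 js ms ks v)"
      unfolding ball_Un by (rule arg_cong2[of _ _ _ _ "(\<and>)"])
    then show ?thesis unfolding stack_def by blast
  qed
  also have "\<dots> \<longleftrightarrow> (\<forall>(u, v)\<in>(stack d1 d2)\<^sup>+. lab3 js ms ks u = lab3 js ms ks v)"
  proof
    assume *: "\<forall>(u, v)\<in>stack d1 d2. lab3 js ms ks u = lab3 js ms ks v"
    have "lab3 js ms ks u = lab3 js ms ks v" if "(u, v) \<in> (stack d1 d2)\<^sup>+" for u v
      using that by induction (use * in auto)
    then show "\<forall>(u, v)\<in>(stack d1 d2)\<^sup>+. lab3 js ms ks u = lab3 js ms ks v" by auto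
  qed auto
  finally show ?thesis .
qed

lemma ball_minus_empty:
  "(\<forall>B\<in>X - {{}}. \<forall>a\<in>B. \<forall>b\<in>B. f a = f b) \<longleftrightarrow> (\<forall>B\<in>X. \<forall>a\<in>B. \<forall>b\<in>B. f a = f b)"
  by auto

lemma card_middle_labels:
  assumes d: "d1 \<in> diagrams n" "d2 \<in> diagrams n"
    and js: "js \<in> multi_indices n r" and ks: "ks \<in> multi_indices n r"
  shows "card {ms \<in> multi_indices n r. delta d1 js ms \<and> delta d2 ms ks} =
    (if delta (diagram_comp n d1 d2) js ks then r ^ card (middle_comps n d1 d2) else 0)"
proof -
  define R where "R = (stack d1 d2)\<^sup>+"
  define S where "S = {ms \<in> multi_indices n r. delta d1 js ms \<and> delta d2 ms ks}"
  define M where "M = middle_comps n d1 d2"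
  define out :: "nat + nat \<Rightarrow> nat + nat + nat" where "out = map_sum id Inr"
  define lab where "lab = case_sum ((!) js) ((!) ks)"
  have eqR: "equiv (three_rows n) R" unfolding R_def by (rule equiv_stack[OF d])
  have S_iff: "ms \<in> S \<longleftrightarrow> ms \<in> multi_indices n r \<and>
      (\<forall>u v. (u, v) \<in> R \<longrightarrow> lab3 js ms ks u = lab3 js ms ks v)" for ms
    unfolding S_def mem_Collect_eq delta_stack R_def by blast
  have S_R: "lab3 js ms ks u = lab3 js ms ks v" if "ms \<in> S" "(u, v) \<in> R" for ms u v
    using that S_iff by blast
  have lab_out: "lab3 js ms ks (out a) = lab a" for ms a
    by (cases a) (auto simp: lab3_def out_def lab_def)
  have delta_iff: "delta (diagram_comp n d1 d2) js ks \<longleftrightarrow>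
      (\<forall>a b. (out a, out b) \<in> R \<longrightarrow> lab a = lab b)"
  proof -
    have "delta (diagram_comp n d1 d2) js ks \<longleftrightarrow>
        (\<forall>B\<in>(vimage out) ` (three_rows n // R). \<forall>a\<in>B. \<forall>b\<in>B. lab a = lab b)"
      unfolding delta_def diagram_comp_def lab_def out_def stack_comps_def R_def
      by (rule ball_minus_empty)
    also have "\<dots> \<longleftrightarrow>
        (\<forall>C\<in>three_rows n // R. \<forall>a b. out a \<in> C \<longrightarrow> out b \<in> C \<longrightarrow> lab a = lab b)"
      unfolding ball_simps(9) Ball_def vimage_eq by blast
    also have "\<dots> \<longleftrightarrow> (\<forall>a b. (out a, out b) \<in> R \<longrightarrow> lab a = lab b)"
    proof (intro iffI allI impI ballI)
      fix a b assume *: "\<forall>C\<in>three_rows n // R. \<forall>a b. out a \<in> C \<longrightarrow> out b \<in> C \<longrightarrow> lab a = lab b"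
        and ab: "(out a, out b) \<in> R"
      then have "out a \<in> three_rows n" using eqR by (auto simp: equiv_def)
      then have "R `` {out a} \<in> three_rows n // R" "out a \<in> R `` {out a}"
        by (rule quotientI, rule equiv_class_self[OF eqR])
      moreover have "out b \<in> R `` {out a}" using ab by simp
      ultimately show "lab a = lab b" using * by (metis (no_types))
    next
      fix C a b assume *: "\<forall>a b. (out a, out b) \<in> R \<longrightarrow> lab a = lab b"
        and C: "C \<in> three_rows n // R" "out a \<in> C" "out b \<in> C"
      have "(out a, out b) \<in> R" using C by (intro in_quotient_imp_in_rel[OF eqR C(1)]) simp
      with * show "lab a = lab b" by simp
    qed
    finally show ?thesis .
  qed
  show ?thesis
  proof (cases "delta (diagram_comp n d1 d2) js ks")
    case False
    then obtain a b where "(out a, out b) \<in> R" "lab a \<noteq> lab b" using delta_iff by blast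
    then have "ms \<notin> S" for ms using S_iff lab_out by metis
    then have "S = {}" by blast
    then have "card S = 0" by simp
    with False show ?thesis unfolding S_def by simp
  next
    case True
    then have lab_eq: "lab a = lab b" if "(out a, out b) \<in> R" for a b
      using delta_iff that by simp
    have M_iff: "C \<in> M \<longleftrightarrow> C \<in> three_rows n // R \<and> (\<forall>a. out a \<notin> C)" for C
    proof -
      have "C \<subseteq> range (Inr \<circ> Inl) \<longleftrightarrow> (\<forall>a. out a \<notin> C)"
      proof
        assume L: "C \<subseteq> range (Inr \<circ> Inl)"
        show "\<forall>a. out a \<notin> C"
        proof
          fix a show "out a \<notin> C" using L by (cases a) (auto simp: out_def)
        qed
      next
        assume L: "\<forall>a. out a \<notin> C"
        show "C \<subseteq> range (Inr \<circ> Inl)"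
        proof
          fix x assume "x \<in> C"
          then have "x \<noteq> out (Inl i)" "x \<noteq> out (Inr i)" for i using L by metis+
          then have "x \<noteq> Inl i" "x \<noteq> Inr (Inr i)" for i by (simp_all add: out_def)
          then obtain i where "x = Inr (Inl i)" by (metis sum.exhaust)
          then show "x \<in> range (Inr \<circ> Inl)" by simp
        qed
      qed
      then show ?thesis by (auto simp: M_def middle_comps_def stack_comps_def R_def)
    qed
    have class_self: "v \<in> R `` {v}" if "v \<in> three_rows n" for v
      using equiv_class_self[OF eqR that] .
    have M_mid: "\<exists>i<n. C = R `` {Inr (Inl i)}" if "C \<in> M" for C
    proof -
      from that obtain v where v: "v \<in> three_rows n" "C = R `` {v}"
        using M_iff by (auto elim: quotientE)
      then have "v \<in> C" using class_self by auto
      then have "\<forall>a. v \<noteq> out a" using M_iff[of C] that by auto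
      then have "v \<noteq> out (Inl i)" "v \<noteq> out (Inr i)" for i by metis+
      then have "v \<noteq> Inl i" "v \<noteq> Inr (Inr i)" for i by (simp_all add: out_def)
      with v show ?thesis unfolding three_rows_def by auto
    qed
    have finM: "finite M"
      using finite_subset[of M "(\<lambda>i. R `` {Inr (Inl i)}) ` {..<n}"] M_mid by blast
    define rep where "rep C = (SOME i. i < n \<and> C = R `` {Inr (Inl i)})" for C
    have rep: "rep C < n" "C = R `` {Inr (Inl (rep C))}" if "C \<in> M" for C
      using someI_ex[OF M_mid[OF that, unfolded Bex_def]] unfolding rep_def by auto
    have mid_row: "Inr (Inl i) \<in> three_rows n" if "i < n" for i
      using that by (auto simp: three_rows_def)
    define F where "F ms = (\<lambda>C\<in>M. ms ! rep C)" for ms :: "nat list"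
    have nth_lt: "ms ! i < r" if "ms \<in> multi_indices n r" "i < n" for ms i
    proof -
      have "ms ! i \<in> set ms" using that by (intro nth_mem) (simp add: multi_indices_def)
      moreover have "set ms \<subseteq> {..<r}" using that by (simp add: multi_indices_def)
      ultimately show ?thesis by blast
    qed
    have "bij_betw F S (M \<rightarrow>\<^sub>E {..<r})"
    proof (rule bij_betw_imageI)
      show "inj_on F S"
      proof (rule inj_onI)
        fix ms ms' assume ms: "ms \<in> S" and ms': "ms' \<in> S" and eq: "F ms = F ms'"
        show "ms = ms'"
        proof (rule nth_equalityI)
          show "length ms = length ms'" using ms ms' by (auto simp: S_iff multi_indices_def)
          fix i assume "i < length ms"
          then have i: "i < n" using ms by (auto simp: S_iff multi_indices_def)
          define C where "C = R `` {Inr (Inl i)}"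
          have CQ: "C \<in> three_rows n // R" unfolding C_def by (rule quotientI[OF mid_row[OF i]])
          show "ms ! i = ms' ! i"
          proof (cases "C \<in> M")
            case True
            have "R `` {Inr (Inl i)} = R `` {Inr (Inl (rep C))}"
              unfolding C_def[symmetric] by (rule rep(2)[OF True])
            then have "(Inr (Inl i), Inr (Inl (rep C))) \<in> R"
              by (rule eq_equiv_class[OF _ eqR]) (rule mid_row[OF rep(1)[OF True]])
            then have "lab3 js ms ks (Inr (Inl i)) = lab3 js ms ks (Inr (Inl (rep C)))"
              "lab3 js ms' ks (Inr (Inl i)) = lab3 js ms' ks (Inr (Inl (rep C)))"
              using S_R[OF ms] S_R[OF ms'] by metis+
            then have "ms ! i = ms ! rep C" "ms' ! i = ms' ! rep C"
              by (simp_all add: lab3_def)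
            moreover have "ms ! rep C = ms' ! rep C"
              using fun_cong[OF eq, of C] True by (simp add: F_def)
            ultimately show ?thesis by simp
          next
            case False
            then obtain a where "out a \<in> C" using M_iff[of C] CQ by auto
            then have "(Inr (Inl i), out a) \<in> R" by (simp add: C_def)
            then have "lab3 js ms ks (Inr (Inl i)) = lab a" "lab3 js ms' ks (Inr (Inl i)) = lab a"
              using S_R[OF ms] S_R[OF ms'] lab_out by metis+
            then show ?thesis by (simp add: lab3_def)
          qed
        qed
      qed
      show "F ` S = M \<rightarrow>\<^sub>E {..<r}"
      proof
        show "F ` S \<subseteq> M \<rightarrow>\<^sub>E {..<r}"
        proof
          fix f assume "f \<in> F ` S"
          then obtain ms where "ms \<in> multi_indices n r" "f = F ms" using S_iff by blast
          then show "f \<in> M \<rightarrow>\<^sub>E {..<r}" using nth_lt rep(1) by (simp add: F_def)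
        qed
        show "M \<rightarrow>\<^sub>E {..<r} \<subseteq> F ` S"
        proof
          fix g assume g: "g \<in> M \<rightarrow>\<^sub>E {..<r}"
          define L where "L C = (if C \<in> M then g C else lab (SOME a. out a \<in> C))" for C
          define ms where "ms = map (\<lambda>i. L (R `` {Inr (Inl i)})) [0..<n]"
          have outL: "lab a = L (R `` {out a})" if "out a \<in> three_rows n" for a
          proof -
            have self: "out a \<in> R `` {out a}" by (rule class_self[OF that])
            then have nM: "R `` {out a} \<notin> M" using M_iff[of "R `` {out a}"] by auto
            have "out (SOME b. out b \<in> R `` {out a}) \<in> R `` {out a}"
              by (rule someI[of "\<lambda>b. out b \<in> R `` {out a}", OF self])
            then have "lab a = lab (SOME b. out b \<in> R `` {out a})" by (intro lab_eq) simp
            then show ?thesis using nM by (simp add: L_def)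
          qed
          have lab3_L: "lab3 js ms ks v = L (R `` {v})" if v: "v \<in> three_rows n" for v
          proof -
            have outer: ?thesis if "v = out a" for a
              using outL[of a] lab_out[of ms a] v that by simp
            from v consider i where "v = Inl i" | i where "i < n" "v = Inr (Inl i)"
              | i where "v = Inr (Inr i)"
              by (auto simp: three_rows_def)
            then show ?thesis
            proof cases
              case (1 i)
              then show ?thesis using outer[of "Inl i"] by (simp add: out_def)
            next
              case (2 i)
              then show ?thesis by (simp add: lab3_def ms_def)
            next
              case (3 i)
              then show ?thesis using outer[of "Inr i"] by (simp add: out_def)
            qed
          qed
          have "ms ! i < r" if i: "i < n" for i
          proof (cases "R `` {Inr (Inl i)} \<in> M")
            case True
            then show ?thesis using g i by (auto simp: ms_def L_def)
          next
            case False
            then obtain a where a: "out a \<in> R `` {Inr (Inl i)}"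
              using M_iff[of "R `` {Inr (Inl i)}"] quotientI[OF mid_row[OF i], of R] by auto
            then have aR: "(Inr (Inl i), out a) \<in> R" by simp
            then have a3: "out a \<in> three_rows n" using eqR by (auto simp: equiv_def)
            have "ms ! i = L (R `` {Inr (Inl i)})" using i by (simp add: ms_def)
            also have "R `` {Inr (Inl i)} = R `` {out a}" by (rule equiv_class_eq[OF eqR aR])
            also have "L \<dots> = lab a" using outL[OF a3] by simp
            also have "lab a < r"
              using a3 nth_lt[OF js] nth_lt[OF ks]
              by (cases a) (auto simp: lab_def out_def three_rows_def)
            finally show ?thesis .
          qed
          moreover have "length ms = n" by (simp add: ms_def)
          ultimately have "ms \<in> multi_indices n r"
            unfolding multi_indices_def by (auto simp del: nth_map simp: in_set_conv_nth)
          moreover have "lab3 js ms ks u = lab3 js ms ks v" if uv: "(u, v) \<in> R" for u v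
          proof -
            have "u \<in> three_rows n" "v \<in> three_rows n" using uv eqR by (auto simp: equiv_def)
            then show ?thesis using lab3_L equiv_class_eq[OF eqR uv] by metis
          qed
          ultimately have "ms \<in> S" by (intro S_iff[THEN iffD2] conjI allI impI)
          moreover have "F ms = g"
          proof
            fix C show "F ms C = g C"
            proof (cases "C \<in> M")
              case True
              have "F ms C = L (R `` {Inr (Inl (rep C))})"
                using True rep(1)[OF True] by (simp add: F_def ms_def)
              also have "\<dots> = L C" using rep(2)[OF True] by (rule arg_cong[OF sym])
              finally show ?thesis using True by (simp add: L_def)
            next
              case False
              then show ?thesis using g by (auto simp: F_def)
            qed
          qed
          ultimately show "g \<in> F ` S" by blast
        qed
      qed
    qed
    then have "card S = card (M \<rightarrow>\<^sub>E {..<r})" by (rule bij_betw_same_card)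
    also have "\<dots> = r ^ card M" using finM by (simp add: card_PiE)
    finally show ?thesis using True by (simp add: S_def M_def)
  qed
qed


lemma diagram_act_comp:
  assumes "d1 \<in> diagrams n" "d2 \<in> diagrams n"
  shows "diagram_act n r d1 (diagram_act n r d2 w) =
    fscale (of_nat r ^ card (middle_comps n d1 d2)) (diagram_act n r (diagram_comp n d1 d2) w)"
proof
  fix js
  let ?I = "multi_indices n r" and ?c = "of_nat r ^ card (middle_comps n d1 d2) :: complex"
  let ?d = "diagram_comp n d1 d2"
  show "diagram_act n r d1 (diagram_act n r d2 w) js = fscale ?c (diagram_act n r ?d w) js"
  proof (cases "js \<in> ?I")
    case False
    then show ?thesis by (simp add: diagram_act_def fscale_def)
  next
    case True
    have "diagram_act n r d1 (diagram_act n r d2 w) js =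
        (\<Sum>ms\<in>?I. \<Sum>ks\<in>?I. of_bool (delta d1 js ms \<and> delta d2 ms ks) * w ks)"
      using True
      by (simp add: diagram_act_def sum_distrib_left of_bool_conj mult.assoc cong: sum.cong)
    also have "\<dots> = (\<Sum>ks\<in>?I. (\<Sum>ms\<in>?I. of_bool (delta d1 js ms \<and> delta d2 ms ks)) * w ks)"
      by (subst sum.swap) (simp add: sum_distrib_right)
    also have "\<dots> = (\<Sum>ks\<in>?I. ?c * (of_bool (delta ?d js ks) * w ks))"
    proof (rule sum.cong)
      fix ks assume ks: "ks \<in> ?I"
      have "(\<Sum>ms\<in>?I. of_bool (delta d1 js ms \<and> delta d2 ms ks)) =
          (of_nat (card {ms \<in> ?I. delta d1 js ms \<and> delta d2 ms ks}) :: complex)"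
        by (simp add: sum_of_bool_eq finite_multi_indices Int_def)
      also have "\<dots> = ?c * of_bool (delta ?d js ks)"
        unfolding card_middle_labels[OF assms True ks] by simp
      finally show "(\<Sum>ms\<in>?I. of_bool (delta d1 js ms \<and> delta d2 ms ks)) * w ks =
          ?c * (of_bool (delta ?d js ks) * w ks)" by (simp add: mult.assoc)
    qed simp
    also have "\<dots> = fscale ?c (diagram_act n r ?d w) js"
      using True by (simp add: diagram_act_def fscale_def sum_distrib_left)
    finally show ?thesis .
  qed
qed

lemma diagram_act_sum:
  "diagram_act n r d (\<lambda>js. \<Sum>e\<in>E. y e * f e js) js = (\<Sum>e\<in>E. y e * diagram_act n r d (f e) js)"
  unfolding diagram_act_def
  by (auto simp: sum_distrib_left mult.left_commute intro: sum.swap)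

lemma pa_act_mult: "pa_act n r x (pa_act n r y w) = pa_act n r (pa_mult n r x y) w"
proof
  fix js
  let ?D = "diagrams n" and ?c = "\<lambda>d1 d2. of_nat r ^ card (middle_comps n d1 d2) :: complex"
  have "pa_act n r x (pa_act n r y w) js =
      (\<Sum>d1\<in>?D. \<Sum>d2\<in>?D. x d1 * y d2 * diagram_act n r d1 (diagram_act n r d2 w) js)"
    unfolding pa_act_def by (simp add: diagram_act_sum sum_distrib_left mult.assoc)
  also have "\<dots> = (\<Sum>d1\<in>?D. \<Sum>d2\<in>?D.
      x d1 * y d2 * ?c d1 d2 * diagram_act n r (diagram_comp n d1 d2) w js)"
    by (intro sum.cong refl) (simp add: diagram_act_comp fscale_def)
  also have "\<dots> = (\<Sum>d1\<in>?D. \<Sum>d2\<in>?D. \<Sum>d\<in>?D.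
      x d1 * y d2 * ?c d1 d2 * diagram_elt (diagram_comp n d1 d2) d * diagram_act n r d w js)"
  proof (intro sum.cong refl)
    fix d1 d2 assume "d1 \<in> ?D" "d2 \<in> ?D"
    then have c: "diagram_comp n d1 d2 \<in> ?D" by (rule diagram_comp_in_diagrams)
    have "(\<Sum>d\<in>?D. x d1 * y d2 * ?c d1 d2 * diagram_elt (diagram_comp n d1 d2) d *
        diagram_act n r d w js) = (\<Sum>d\<in>?D. if d = diagram_comp n d1 d2
        then x d1 * y d2 * ?c d1 d2 * diagram_act n r d w js else 0)"
      by (intro sum.cong refl) (simp add: diagram_elt_def)
    also have "\<dots> = x d1 * y d2 * ?c d1 d2 * diagram_act n r (diagram_comp n d1 d2) w js"
      using c by (simp add: sum.delta finite_diagrams)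
    finally show "x d1 * y d2 * ?c d1 d2 * diagram_act n r (diagram_comp n d1 d2) w js =
      (\<Sum>d\<in>?D. x d1 * y d2 * ?c d1 d2 * diagram_elt (diagram_comp n d1 d2) d *
        diagram_act n r d w js)" by simp
  qed
  also have "\<dots> = (\<Sum>d1\<in>?D. \<Sum>d\<in>?D. \<Sum>d2\<in>?D.
      x d1 * y d2 * ?c d1 d2 * diagram_elt (diagram_comp n d1 d2) d * diagram_act n r d w js)"
    by (rule sum.cong[OF refl], rule sum.swap)
  also have "\<dots> = (\<Sum>d\<in>?D. \<Sum>d1\<in>?D. \<Sum>d2\<in>?D.
      x d1 * y d2 * ?c d1 d2 * diagram_elt (diagram_comp n d1 d2) d * diagram_act n r d w js)"
    by (rule sum.swap)
  also have "\<dots> = pa_act n r (pa_mult n r x y) w js"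
    unfolding pa_act_def pa_mult_def by (simp add: sum_distrib_right)
  finally show "pa_act n r x (pa_act n r y w) js = pa_act n r (pa_mult n r x y) w js" .
qed

lemma multi_indices_map:
  assumes "\<sigma> permutes {..<r}"
  shows "map \<sigma> js \<in> multi_indices n r \<longleftrightarrow> js \<in> multi_indices n r"
proof -
  have "(\<sigma> j < r) = (j < r)" for j using permutes_in_image[OF assms, of j] by simp
  then show ?thesis by (auto simp: multi_indices_def)
qed

lemma delta_map:
  assumes "d \<in> diagrams n" "inj \<sigma>" "length js = n" "length ks = n"
  shows "delta d (map \<sigma> js) (map \<sigma> ks) \<longleftrightarrow> delta d js ks"
proof -
  have "case_sum ((!) (map \<sigma> js)) ((!) (map \<sigma> ks)) a = \<sigma> (case_sum ((!) js) ((!) ks) a)"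
    if "B \<in> d" "a \<in> B" for a B
  proof -
    have "\<Union>d = {..<n} <+> {..<n}"
      using assms(1) by (simp add: diagrams_def partition_on_def)
    with that have "a \<in> {..<n} <+> {..<n}" by blast
    then show ?thesis using assms(3,4) by (cases a) auto
  qed
  then show ?thesis unfolding delta_def using inj_eq[OF assms(2)]
    by (intro ball_cong refl) simp
qed

lemma diagram_act_commute:
  assumes d: "d \<in> diagrams n" and \<sigma>: "\<sigma> permutes {..<r}"
  shows "diagram_act n r d (tensor_act \<sigma> w) = tensor_act \<sigma> (diagram_act n r d w)"
proof
  fix js
  let ?I = "multi_indices n r" and ?s = "Hilbert_Choice.inv \<sigma>"
  have s: "?s permutes {..<r}" using \<sigma> by (rule permutes_inv)
  have id: "map \<sigma> (map ?s ks) = ks" "map ?s (map \<sigma> ks) = ks" for ks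
    using permutes_inverses[OF \<sigma>] by (simp_all add: map_idI)
  have "(\<Sum>ks\<in>?I. of_bool (delta d js ks) * w (map ?s ks)) =
      (\<Sum>ks\<in>?I. of_bool (delta d (map ?s js) ks) * w ks)" if js: "js \<in> ?I"
  proof (rule sum.reindex_bij_witness[of _ "map \<sigma>" "map ?s"])
    fix ks assume ks: "ks \<in> ?I"
    show "map \<sigma> (map ?s ks) = ks" "map ?s (map \<sigma> ks) = ks" by (fact id)+
    show "map ?s ks \<in> ?I" "map \<sigma> ks \<in> ?I" using ks multi_indices_map s \<sigma> by blast+
    show "of_bool (delta d (map ?s js) (map ?s ks)) * w (map ?s ks) =
        of_bool (delta d js ks) * w (map ?s ks)"
      using delta_map[OF d permutes_inj[OF s], of js ks] js ks by (simp add: multi_indices_def)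
  qed
  then show "diagram_act n r d (tensor_act \<sigma> w) js = tensor_act \<sigma> (diagram_act n r d w) js"
    using multi_indices_map[OF s] by (simp add: diagram_act_def tensor_act_def)
qed

lemma pa_act_add: "pa_act n r x (v + w) = pa_act n r x v + pa_act n r x w"
proof
  fix js
  have "diagram_act n r d (v + w) js = diagram_act n r d v js + diagram_act n r d w js" for d
    by (simp add: diagram_act_def distrib_left sum.distrib)
  then show "pa_act n r x (v + w) js = (pa_act n r x v + pa_act n r x w) js"
    by (simp add: pa_act_def distrib_left sum.distrib)
qed

lemma pa_act_fscale: "pa_act n r x (fscale c v) = fscale c (pa_act n r x v)"
proof
  fix js
  have *: "diagram_act n r d (fscale c v) js = c * diagram_act n r d v js" for d
    by (simp add: diagram_act_def fscale_def sum_distrib_left mult.left_commute)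
  have "pa_act n r x (fscale c v) js = (\<Sum>d\<in>diagrams n. x d * (c * diagram_act n r d v js))"
    unfolding pa_act_def by (simp only: *)
  also have "\<dots> = c * pa_act n r x v js"
    unfolding pa_act_def sum_distrib_left by (rule sum.cong) (simp_all add: mult.left_commute)
  also have "\<dots> = fscale c (pa_act n r x v) js"
    by (simp only: fscale_def)
  finally show "pa_act n r x (fscale c v) js = fscale c (pa_act n r x v) js" .
qed

lemma pa_act_tensor_space: "pa_act n r x w \<in> tensor_space n r"
  by (simp add: pa_act_def diagram_act_def tensor_space_def)

lemma pa_act_commute:
  assumes "\<sigma> permutes {..<r}"
  shows "pa_act n r x (tensor_act \<sigma> w) = tensor_act \<sigma> (pa_act n r x w)"
proof
  fix js
  have "pa_act n r x (tensor_act \<sigma> w) js =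
      (\<Sum>d\<in>diagrams n. x d * tensor_act \<sigma> (diagram_act n r d w) js)"
    unfolding pa_act_def using diagram_act_commute[OF _ assms] by simp
  then show "pa_act n r x (tensor_act \<sigma> w) js = tensor_act \<sigma> (pa_act n r x w) js"
    by (simp add: tensor_act_def pa_act_def)
qed

lemma mult_space_closed:
  assumes "\<phi> \<in> mult_space n r lam"
  shows "(\<lambda>v. pa_act n r x (\<phi> v)) \<in> mult_space n r lam"
proof -
  have zero: "pa_act n r x 0 = 0"
    using pa_act_fscale[of n r x 0 0] by (simp only: fun_vs.scale_zero_left)
  note * = assms[unfolded mult_space_def mem_Collect_eq]
  note \<phi> = *[THEN conjunct1, rule_format]
    *[THEN conjunct2, THEN conjunct2, THEN conjunct1, rule_format]
    *[THEN conjunct2, THEN conjunct2, THEN conjunct2, THEN conjunct1, rule_format]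
    *[THEN conjunct2, THEN conjunct2, THEN conjunct2, THEN conjunct2, rule_format]
  show ?thesis unfolding mult_space_def mem_Collect_eq
  proof (intro conjI allI ballI impI)
    show "pa_act n r x (\<phi> v) = 0" if "v \<notin> specht lam" for v
      by (simp only: \<phi>(1)[OF that] zero)
    show "pa_act n r x (\<phi> v) \<in> tensor_space n r" for v by (rule pa_act_tensor_space)
    show "pa_act n r x (\<phi> (v + w)) = pa_act n r x (\<phi> v) + pa_act n r x (\<phi> w)"
      if "v \<in> specht lam" "w \<in> specht lam" for v w
      by (simp only: \<phi>(2)[OF that] pa_act_add)
    show "pa_act n r x (\<phi> (fscale c v)) = fscale c (pa_act n r x (\<phi> v))"
      if "v \<in> specht lam" for c v by (simp only: \<phi>(3)[OF that] pa_act_fscale)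
    show "pa_act n r x (\<phi> (tabloid_act \<sigma> v)) = tensor_act \<sigma> (pa_act n r x (\<phi> v))"
      if "\<sigma> permutes {..<r}" "v \<in> specht lam" for \<sigma> v
      by (simp only: \<phi>(4)[OF that] pa_act_commute[OF that(1)])
  qed
qed

end

theory Submission
  imports Defs
begin

text \<open>Let \<open>lam = l # mu\<close>, so that \<open>r = l + n\<close> with \<open>n = |mu|\<close>.  The theorem says that the character of the
  irreducible module \<open>M\<close> of \<open>P\<^sub>n(r)\<close> at \<open>lam\<close> vanishes on every diagram with fewer than \<open>n\<close> propagating
  blocks, and is the character of the Specht module of \<open>mu\<close> on the remaining diagrams, which are the
  \<open>n!\<close> permutation diagrams.  The recombinant then has exactly the terms of the immanant.

  Here \<open>M\<close> is the space of \<open>S\<^sub>r\<close>-homomorphisms from the Specht module \<open>S\<close> of \<open>lam\<close> to tensor space.  All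
  arguments rest on one fact: a tableau of shape \<open>lam\<close> has only \<open>l\<close> columns, so among any \<open>l + 1\<close> entries
  two share a column, and their transposition negates the polytabloid
  (\<open>exists_transpose_negating_polytabloid\<close>).

  Vanishing: let \<open>\<phi>\<close> be in \<open>M\<close> and suppose that there are more than \<open>r - n = l\<close> values such that transposing
  any two of them in a certain multi-index does not affect the coefficients there of the tensors \<open>\<phi> v\<close>.
  Then these coefficients are zero (\<open>eval_0_if_swaps_fix\<close>).  This applies to multi-indices with a repeated
  value (\<open>mult_space_support\<close>).  After acting by a diagram with fewer than \<open>n\<close> propagating blocks, it applies
  to all multi-indices at which the coefficients are not zero by definition of the action
  (\<open>pa_char_eq_0_if_propagation_number_less\<close>).

  Permutation diagrams: since \<open>\<phi> v\<close> is supported on injective multi-indices, which form one \<open>S\<^sub>r\<close>-orbit,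
  \<open>\<phi>\<close> is determined by the functional \<open>v \<mapsto> \<phi> v [0..<n]\<close> on \<open>S\<close>.  It is invariant under all permutations of
  \<open>K = {n..<r}\<close>.  Restricting elements of \<open>S\<close> to the tabloids with first row \<open>K\<close>, and deleting that row, is
  a map \<open>R\<close> from \<open>S\<close> onto the Specht module of \<open>mu\<close> that commutes with \<open>S\<^sub>n\<close>.  It is injective on the elements
  invariant under the permutations of \<open>K\<close> (\<open>invariant_eq_0_if_drop_first_row_eq_0\<close>), so by averaging the
  invariant functionals are precisely the functionals that factor through \<open>R\<close>.  Thus \<open>M\<close> is the dual of
  the Specht module of \<open>mu\<close> (\<open>mult_space_decomposition\<close>), with permutation diagrams acting by the
  transposed action, and the characters agree (\<open>pa_char_perm_diagram\<close>).\<close>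

section \<open>Traces in coordinates\<close>

text \<open>If \<open>\<Sum>\<^sub>i l\<^sub>i(\<cdot>) e\<^sub>i\<close> is the identity of \<open>U\<close>, then \<open>f = \<Sum>\<^sub>i l\<^sub>i(\<cdot>) f(e\<^sub>i)\<close> on \<open>U\<close>, a sum of maps of
  rank at most one, and the \<open>i\<close>-th of these has trace \<open>l\<^sub>i(f(e\<^sub>i))\<close>.  In this form a trace can be read
  off from a decomposition of the identity, without first turning the \<open>e\<^sub>i\<close> into a basis.\<close>

lemma (in vector_space) trace_on_eq_sum_coordinates:
  assumes U: "subspace U" and I: "finite I" and e: "\<And>i. i \<in> I \<Longrightarrow> e i \<in> U"
    and decomp: "\<And>u. u \<in> U \<Longrightarrow> u = (\<Sum>i\<in>I. scale (l i u) (e i))"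
    and l_add: "\<And>i u v. l i (u + v) = l i u + l i v"
    and l_scale: "\<And>i c u. l i (scale c u) = c * l i u"
    and f_add: "\<And>u v. f (u + v) = f u + f v"
    and f_scale: "\<And>c u. f (scale c u) = scale c (f u)"
    and f_in: "\<And>u. u \<in> U \<Longrightarrow> f u \<in> U"
  shows "trace_on U f = (\<Sum>i\<in>I. l i (f (e i)))"
proof -
  define B where "B = (SOME B. independent B \<and> span B = U)"
  obtain B0 where "B0 \<subseteq> U" "independent B0" "U \<subseteq> span B0"
    using maximal_independent_subset by blast
  then have "\<exists>B. independent B \<and> span B = U"
    using span_minimal[OF _ U] by blast
  then have B: "independent B" "span B = U"
    using someI_ex[of "\<lambda>B. independent B \<and> span B = U"] by (auto simp: B_def)
  have "u \<in> span (e ` I)" if "u \<in> U" for u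
    by (subst decomp[OF that]) (intro span_sum span_scale span_base imageI)
  then have fin: "finite B"
    using independent_span_bound[OF finite_imageI[OF I] B(1)] B(2) span_superset by blast
  have BU: "b \<in> U" if "b \<in> B" for b using that B(2) span_base by blast
  have f_sum: "f (\<Sum>a\<in>S. g a) = (\<Sum>a\<in>S. f (g a))" if "finite S" for g and S :: "'b set"
    using that by (induction S rule: finite_induct) (use f_scale[of 0 0] f_add in auto)
  have l_sum: "l i (\<Sum>a\<in>S. g a) = (\<Sum>a\<in>S. l i (g a))" if "finite S" for i g and S :: "'b set"
    using that by (induction S rule: finite_induct) (use l_scale[of i 0 0] l_add in auto)
  let ?\<rho> = "representation B"
  have "trace_on U f = (\<Sum>b\<in>B. ?\<rho> (f b) b)"
    by (simp add: trace_on_def B_def Let_def)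
  also have "\<dots> = (\<Sum>b\<in>B. \<Sum>i\<in>I. l i (f b) * ?\<rho> (e i) b)"
  proof (rule sum.cong[OF refl])
    fix b assume b: "b \<in> B"
    have "?\<rho> (f b) b = ?\<rho> (\<Sum>i\<in>I. scale (l i (f b)) (e i)) b"
      using decomp[OF f_in[OF BU[OF b]]] by simp
    also have "\<dots> = (\<Sum>i\<in>I. ?\<rho> (scale (l i (f b)) (e i)) b)"
      by (subst representation_sum[OF B(1)]) (use e B(2) U subspace_scale in auto)
    also have "\<dots> = (\<Sum>i\<in>I. l i (f b) * ?\<rho> (e i) b)"
      by (intro sum.cong refl, subst representation_scale[OF B(1)]) (use e B(2) in auto)
    finally show "?\<rho> (f b) b = \<dots>" .
  qed
  also have "\<dots> = (\<Sum>i\<in>I. \<Sum>b\<in>B. l i (f b) * ?\<rho> (e i) b)"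
    by (rule sum.swap)
  also have "\<dots> = (\<Sum>i\<in>I. l i (f (e i)))"
  proof (rule sum.cong[OF refl])
    fix i assume i: "i \<in> I"
    have "e i = (\<Sum>b\<in>B. scale (?\<rho> (e i) b) b)"
      using sum_representation_eq[OF B(1) _ fin order_refl] e[OF i] B(2) by simp
    then have "l i (f (e i)) = l i (f (\<Sum>b\<in>B. scale (?\<rho> (e i) b) b))" by simp
    also have "\<dots> = (\<Sum>b\<in>B. l i (f b) * ?\<rho> (e i) b)"
      by (simp add: f_sum l_sum fin f_scale l_scale mult.commute)
    finally show "(\<Sum>b\<in>B. l i (f b) * ?\<rho> (e i) b) = l i (f (e i))" by simp
  qed
  finally show ?thesis .
qed

section \<open>The symmetric group acting on Specht modules\<close>


lemma sum_fun_apply: "(\<Sum>a\<in>S. g a) x = (\<Sum>a\<in>S. g a x)"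
  by (induction S rule: infinite_finite_induct) auto

lemma tabloid_act_add: "tabloid_act \<sigma> (v + w) = tabloid_act \<sigma> v + tabloid_act \<sigma> w"
  by (simp add: tabloid_act_def fun_eq_iff)

lemma tabloid_act_fscale: "tabloid_act \<sigma> (fscale c v) = fscale c (tabloid_act \<sigma> v)"
  by (simp add: tabloid_act_def fscale_def)

lemma tabloid_act_uminus: "tabloid_act \<sigma> (- v) = - tabloid_act \<sigma> v"
  by (simp add: tabloid_act_def fun_eq_iff)

lemma tabloid_act_comp:
  assumes "\<sigma> permutes S" "\<tau> permutes S"
  shows "tabloid_act \<sigma> (tabloid_act \<tau> v) = tabloid_act (\<sigma> \<circ> \<tau>) v"
  using assms by (simp add: tabloid_act_def o_inv_distrib permutes_bij image_comp)

lemma tabloid_act_sum: "tabloid_act \<sigma> (\<Sum>a\<in>S. g a) = (\<Sum>a\<in>S. tabloid_act \<sigma> (g a))"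
  by (simp add: tabloid_act_def fun_eq_iff sum_fun_apply)

lemma cells_Cons_first_row: "{c \<in> cells (l # mu). fst c = 0} = Pair 0 ` {..<l}"
  by (auto simp: cells_def)

lemma col_stabilizer_comp:
  assumes "p \<in> col_stabilizer lam t" "q \<in> col_stabilizer lam t"
  shows "p \<circ> q \<in> col_stabilizer lam t"
  using assms permutes_compose[of q "{..<sum_list lam}" p]
  unfolding col_stabilizer_def mem_Collect_eq by (simp only: image_comp[symmetric]) blast

lemma col_stabilizer_inv:
  assumes q: "q \<in> col_stabilizer lam t"
  shows "Hilbert_Choice.inv q \<in> col_stabilizer lam t"
proof -
  have p: "q permutes {..<sum_list lam}" using q by (simp add: col_stabilizer_def)
  have "Hilbert_Choice.inv q ` X = X" if "q ` X = X" for X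
    using image_inv_f_f[OF permutes_inj[OF p], of X] that by simp
  then show ?thesis using q permutes_inv[OF p] by (simp add: col_stabilizer_def)
qed

lemma inv_image_eq_iff:
  assumes "p permutes S"
  shows "Hilbert_Choice.inv p ` X = Y \<longleftrightarrow> X = p ` Y"
  using image_inv_f_f[OF permutes_inj[OF assms], of Y]
    image_f_inv_f[OF permutes_surj[OF assms], of X] by auto

lemma tabloid_eq_act_iff:
  assumes "p permutes S"
  shows "(\<lambda>i. Hilbert_Choice.inv p ` T i) = tabloid lam t \<longleftrightarrow> T = tabloid lam (p \<circ> t)"
  by (simp add: fun_eq_iff tabloid_def inv_image_eq_iff[OF assms] image_comp)

lemma tabloid_act_polytabloid_eq_sum:
  assumes "p permutes S"
  shows "tabloid_act p (polytabloid lam t) =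
    (\<lambda>T. \<Sum>q\<in>col_stabilizer lam t. of_int (sign q) * of_bool (T = tabloid lam (p \<circ> q \<circ> t)))"
  unfolding tabloid_act_def polytabloid_def tabloid_eq_act_iff[OF assms] by (simp add: comp_assoc)

lemma col_stabilizer_permutes: "q \<in> col_stabilizer lam t \<Longrightarrow> q permutes {..<sum_list lam}"
  by (simp add: col_stabilizer_def)

lemma sign_comp_permutes:
  assumes "p permutes S" "q permutes S" "finite S"
  shows "sign (p \<circ> q) = sign p * sign q"
  using assms sign_compose permutation_permutes by blast

text \<open>Multiplying by \<open>p\<close> permutes the column stabilizer, and signs are multiplicative.\<close>

lemma tabloid_act_col_stabilizer:
  assumes p: "p \<in> col_stabilizer lam t"
  shows "tabloid_act p (polytabloid lam t) = fscale (of_int (sign p)) (polytabloid lam t)"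
proof
  fix T
  let ?C = "col_stabilizer lam t"
  have pp: "p permutes {..<sum_list lam}" by (rule col_stabilizer_permutes[OF p])
  have "tabloid_act p (polytabloid lam t) T =
     (\<Sum>q\<in>?C. of_int (sign q) * of_bool (T = tabloid lam (p \<circ> q \<circ> t)))"
    by (simp add: tabloid_act_polytabloid_eq_sum[OF pp])
  also have "\<dots> = (\<Sum>q\<in>?C. of_int (sign p) * (of_int (sign q) * of_bool (T = tabloid lam (q \<circ> t))))"
  proof (rule sum.reindex_bij_witness[of _ "\<lambda>q. Hilbert_Choice.inv p \<circ> q" "\<lambda>q. p \<circ> q"])
    fix q assume q: "q \<in> ?C"
    show "Hilbert_Choice.inv p \<circ> (p \<circ> q) = q" "p \<circ> (Hilbert_Choice.inv p \<circ> q) = q"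
      using permutes_inv_o[OF pp] by (simp_all add: o_assoc)
    show "p \<circ> q \<in> ?C" "Hilbert_Choice.inv p \<circ> q \<in> ?C"
      using p q col_stabilizer_comp col_stabilizer_inv by blast+
    have "sign (p \<circ> q) = sign p * sign q"
      by (rule sign_comp_permutes[OF pp col_stabilizer_permutes[OF q]]) simp
    then show "of_int (sign p) * (of_int (sign (p \<circ> q)) * of_bool (T = tabloid lam (p \<circ> q \<circ> t))) =
      (of_int (sign q) * of_bool (T = tabloid lam (p \<circ> q \<circ> t)) :: complex)"
      by (simp add: sign_def)
  qed
  finally show "tabloid_act p (polytabloid lam t) T = fscale (of_int (sign p)) (polytabloid lam t) T"
    by (simp add: fscale_def polytabloid_def sum_distrib_left)
qed

lemma col_stabilizer_conj:
  assumes p: "p permutes {..<sum_list lam}" and q: "q \<in> col_stabilizer lam t"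
  shows "p \<circ> q \<circ> Hilbert_Choice.inv p \<in> col_stabilizer lam (p \<circ> t)"
proof -
  have "(p \<circ> q \<circ> Hilbert_Choice.inv p) ` p ` t ` X = p ` q ` t ` X" for X
    by (simp add: image_comp comp_def permutes_inverses[OF p])
  moreover have "q ` t ` {c \<in> cells lam. snd c = j} = t ` {c \<in> cells lam. snd c = j}" for j
    using q by (simp add: col_stabilizer_def)
  moreover have "p \<circ> q \<circ> Hilbert_Choice.inv p permutes {..<sum_list lam}"
    using p col_stabilizer_permutes[OF q] permutes_inv[OF p] by (intro permutes_compose)
  ultimately show ?thesis
    unfolding col_stabilizer_def mem_Collect_eq image_comp[symmetric, of p t] by simp
qed

lemma sign_conj:
  assumes "p permutes S" "q permutes S" "finite S"
  shows "sign (p \<circ> q \<circ> Hilbert_Choice.inv p) = sign q"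
proof -
  have "sign (p \<circ> q \<circ> Hilbert_Choice.inv p) = sign p * sign q * sign (Hilbert_Choice.inv p)"
    using assms by (simp add: sign_comp_permutes[of _ S] permutes_compose permutes_inv)
  moreover have "sign (Hilbert_Choice.inv p) = sign p"
    using assms permutation_permutes by (intro sign_inverse) blast
  ultimately show ?thesis by (simp add: sign_def)
qed

text \<open>The column stabilizer of \<open>p \<circ> t\<close> is the conjugate by \<open>p\<close> of that of \<open>t\<close>, and conjugation
  preserves signs.\<close>

lemma tabloid_act_polytabloid:
  assumes p: "p permutes {..<sum_list lam}"
  shows "tabloid_act p (polytabloid lam t) = polytabloid lam (p \<circ> t)"
proof
  fix T
  let ?C = "col_stabilizer lam" and ?i = "Hilbert_Choice.inv p"
  have i: "?i permutes {..<sum_list lam}" by (rule permutes_inv[OF p])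
  have o: "?i \<circ> p = id" "p \<circ> ?i = id" using permutes_inv_o[OF p] by auto
  have ii: "Hilbert_Choice.inv ?i = p" by (rule permutes_inv_inv[OF p])
  have it: "?i \<circ> (p \<circ> t) = t" by (simp add: o_assoc o)
  have "tabloid_act p (polytabloid lam t) T =
     (\<Sum>q\<in>?C t. of_int (sign q) * of_bool (T = tabloid lam (p \<circ> q \<circ> t)))"
    by (simp add: tabloid_act_polytabloid_eq_sum[OF p])
  also have "\<dots> = (\<Sum>q\<in>?C (p \<circ> t). of_int (sign q) * of_bool (T = tabloid lam (q \<circ> (p \<circ> t))))"
  proof (rule sum.reindex_bij_witness[of _ "\<lambda>q. ?i \<circ> q \<circ> p" "\<lambda>q. p \<circ> q \<circ> ?i"])
    fix q assume q: "q \<in> ?C t"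
    have "?i \<circ> (p \<circ> q \<circ> ?i) \<circ> p = (?i \<circ> p) \<circ> q \<circ> (?i \<circ> p)" by (simp only: comp_assoc)
    then show "?i \<circ> (p \<circ> q \<circ> ?i) \<circ> p = q" by (simp add: o)
    show "p \<circ> q \<circ> ?i \<in> ?C (p \<circ> t)" by (rule col_stabilizer_conj[OF p q])
    have "p \<circ> q \<circ> ?i \<circ> (p \<circ> t) = p \<circ> q \<circ> (?i \<circ> p) \<circ> t" by (simp only: comp_assoc)
    then show "of_int (sign (p \<circ> q \<circ> ?i)) * of_bool (T = tabloid lam (p \<circ> q \<circ> ?i \<circ> (p \<circ> t))) =
      (of_int (sign q) * of_bool (T = tabloid lam (p \<circ> q \<circ> t)) :: complex)"
      using sign_conj[OF p col_stabilizer_permutes[OF q]] by (simp add: o)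
  next
    fix q assume q: "q \<in> ?C (p \<circ> t)"
    have "p \<circ> (?i \<circ> q \<circ> p) \<circ> ?i = (p \<circ> ?i) \<circ> q \<circ> (p \<circ> ?i)" by (simp only: comp_assoc)
    then show "p \<circ> (?i \<circ> q \<circ> p) \<circ> ?i = q" by (simp add: o)
    show "?i \<circ> q \<circ> p \<in> ?C t"
      using col_stabilizer_conj[OF i q] by (simp only: ii it)
  qed
  finally show "tabloid_act p (polytabloid lam t) T = polytabloid lam (p \<circ> t) T"
    by (simp add: polytabloid_def)
qed

lemma tableau_of_comp:
  assumes "tableau_of lam t" "p permutes {..<sum_list lam}"
  shows "tableau_of lam (p \<circ> t)"
  using assms bij_betw_trans permutes_imp_bij unfolding tableau_of_def by blast

lemma polytabloid_in_specht: "tableau_of lam t \<Longrightarrow> polytabloid lam t \<in> specht lam"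
  unfolding specht_def by (rule fun_vs.span_base) blast

lemma subspace_specht: "fun_vs.subspace (specht lam)"
  by (simp add: specht_def)

lemma specht_induct [consumes 1, case_names zero add]:
  assumes "v \<in> specht lam" "P 0"
    and "\<And>c t v. tableau_of lam t \<Longrightarrow> v \<in> specht lam \<Longrightarrow> P v \<Longrightarrow> P (fscale c (polytabloid lam t) + v)"
  shows "P v"
proof -
  have "v \<in> specht lam \<and> P v"
    using assms(1)[unfolded specht_def]
  proof (induction rule: fun_vs.span_induct_alt)
    case base
    then show ?case using assms(2) fun_vs.subspace_0[OF subspace_specht] by blast
  next
    case (step c x y)
    then obtain t where t: "tableau_of lam t" "x = polytabloid lam t" by blast
    then show ?case using assms(3) step.IH
        fun_vs.subspace_add[OF subspace_specht fun_vs.subspace_scale[OF subspace_specht polytabloid_in_specht]]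
      by blast
  qed
  then show ?thesis ..
qed

lemma tabloid_act_zero [simp]: "tabloid_act \<sigma> 0 = 0"
  by (simp add: tabloid_act_def fun_eq_iff)

lemma tabloid_act_specht:
  assumes p: "p permutes {..<sum_list lam}" and v: "v \<in> specht lam"
  shows "tabloid_act p v \<in> specht lam"
  using v
proof (induction rule: specht_induct)
  case zero
  then show ?case using fun_vs.subspace_0[OF subspace_specht] by (simp only: tabloid_act_zero)
next
  case (add c t v)
  then have "fscale c (polytabloid lam (p \<circ> t)) + tabloid_act p v \<in> specht lam"
    by (intro fun_vs.subspace_add fun_vs.subspace_scale subspace_specht polytabloid_in_specht
        tableau_of_comp[OF _ p])
  then show ?case
    by (simp only: tabloid_act_add tabloid_act_fscale tabloid_act_polytabloid[OF p])
qed

text \<open>Tableaux are functions on all of \<open>\<nat> \<times> \<nat>\<close>, so there are infinitely many of each shape; but the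
  polytabloid sees only the finitely many values on the cells.\<close>

lemma specht_finite_span:
  obtains G where "finite G" "specht lam = fun_vs.span G"
proof
  let ?G = "polytabloid lam ` (cells lam \<rightarrow>\<^sub>E {..<sum_list lam})"
  let ?S = "{polytabloid lam t |t. tableau_of lam t}"
  have "finite (cells lam)"
  proof (rule finite_subset)
    show "cells lam \<subseteq> (\<Union>i<length lam. Pair i ` {..<lam ! i})" by (auto simp: cells_def)
  qed simp
  then have "finite ?G" by (intro finite_imageI finite_PiE) auto
  moreover have "?S \<subseteq> ?G"
  proof
    fix x assume "x \<in> ?S"
    then obtain t where t: "tableau_of lam t" "x = polytabloid lam t" by blast
    have eq: "(q \<circ> restrict t (cells lam)) ` {c \<in> cells lam. P c} = (q \<circ> t) ` {c \<in> cells lam. P c}"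
      for q :: "nat \<Rightarrow> nat" and P
      by (intro image_cong) auto
    have "polytabloid lam (restrict t (cells lam)) = polytabloid lam t"
      unfolding polytabloid_def col_stabilizer_def tabloid_def
      using eq eq[of id, simplified] by simp
    moreover have "restrict t (cells lam) \<in> cells lam \<rightarrow>\<^sub>E {..<sum_list lam}"
      using t(1) by (auto simp: tableau_of_def bij_betw_def)
    ultimately show "x \<in> ?G" using t(2) by (metis imageI)
  qed
  ultimately show "finite ?S" by (rule finite_subset[rotated])
qed (simp add: specht_def)

section \<open>Antisymmetry in the columns\<close>

lemma transpose_in_col_stabilizer:
  assumes t: "tableau_of lam t" and ab: "c \<in> cells lam" "c' \<in> cells lam" "snd c = snd c'"
  shows "transpose (t c) (t c') \<in> col_stabilizer lam t"
proof -
  have inj: "inj_on t (cells lam)" and img: "t ` cells lam = {..<sum_list lam}"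
    using t by (auto simp: tableau_of_def bij_betw_def)
  have mem: "t x \<in> t ` {c \<in> cells lam. snd c = j} \<longleftrightarrow> snd x = j" if "x \<in> cells lam" for x j
    using inj_on_image_mem_iff[OF inj that, of "{c \<in> cells lam. snd c = j}"] that by auto
  have "transpose (t c) (t c') permutes {..<sum_list lam}"
    using ab img by (intro permutes_swap_id) blast+
  then show ?thesis
    unfolding col_stabilizer_def using ab mem by (simp add: transpose_image_eq)
qed

lemma tabloid_act_transpose_polytabloid:
  assumes "tableau_of lam t" "c \<in> cells lam" "c' \<in> cells lam" "snd c = snd c'" "t c \<noteq> t c'"
  shows "tabloid_act (transpose (t c) (t c')) (polytabloid lam t) = - polytabloid lam t"
  using tabloid_act_col_stabilizer[OF transpose_in_col_stabilizer[OF assms(1-4)]] assms(5)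
  by (simp add: sign_swap_id)

text \<open>The pigeonhole principle behind everything that follows: a tableau with first row of length
  \<open>l\<close> has \<open>l\<close> columns, so more than \<open>l\<close> entries cannot all lie in different columns.\<close>

lemma exists_transpose_negating_polytabloid:
  assumes part: "partition_of r (l # mu)" and t: "tableau_of (l # mu) t"
    and X: "X \<subseteq> {..<r}" "card X > l"
  obtains a b where "a \<in> X" "b \<in> X" "a \<noteq> b"
    "tabloid_act (transpose a b) (polytabloid (l # mu) t) = - polytabloid (l # mu) t"
proof -
  let ?D = "{c \<in> cells (l # mu). t c \<in> X}"
  have inj: "inj_on t (cells (l # mu))" and img: "t ` cells (l # mu) = {..<r}"
    using t part by (auto simp: tableau_of_def bij_betw_def partition_of_def)
  have tD: "t ` ?D = X" using X(1) img by auto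
  have "snd ` ?D \<subseteq> {..<l}"
  proof -
    have "(l # mu) ! i \<le> l" if "i < length (l # mu)" for i
      using part that by (cases i) (auto simp: partition_of_def)
    then show ?thesis by (fastforce simp: cells_def)
  qed
  then have "card (snd ` ?D) \<le> l" using card_mono[of "{..<l}"] by fastforce
  moreover have "card ?D = card X"
    using card_image[OF inj_on_subset[OF inj], of ?D] tD by auto
  ultimately have "\<not> inj_on snd ?D" using X(2) card_image by fastforce
  then obtain c c' where c: "c \<in> ?D" "c' \<in> ?D" "snd c = snd c'" "c \<noteq> c'"
    by (auto simp: inj_on_def)
  moreover have "t c \<noteq> t c'" using c inj by (auto dest: inj_onD)
  ultimately show thesis using that[of "t c" "t c'"] tabloid_act_transpose_polytabloid[OF t, of c c'] by auto
qed

text \<open>A transposition of two entries in \<open>X\<close> that negates the polytabloid leaves the sum over all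
  permutations of \<open>X\<close> unchanged, so the symmetrized polytabloid is its own negative.\<close>

lemma symmetrizer_eq_0:
  assumes part: "partition_of r (l # mu)" and v: "v \<in> specht (l # mu)"
    and X: "X \<subseteq> {..<r}" "card X > l"
  shows "(\<Sum>h | h permutes X. tabloid_act h v) = 0"
  using v
proof (induction rule: specht_induct)
  case zero
  then show ?case by (simp only: tabloid_act_zero sum.neutral_const)
next
  case (add c t v)
  let ?e = "polytabloid (l # mu) t"
  obtain a b where ab: "a \<in> X" "b \<in> X" "a \<noteq> b" and neg: "tabloid_act (transpose a b) ?e = - ?e"
    using exists_transpose_negating_polytabloid[OF part add(1) X] by metis
  have s: "transpose a b permutes X" using ab by (intro permutes_swap_id)
  let ?S = "\<Sum>h | h permutes X. tabloid_act h ?e"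
  have "?S = (\<Sum>h | h permutes X. tabloid_act (h \<circ> transpose a b) ?e)"
    by (rule sum.reindex_bij_witness[of _ "\<lambda>h. h \<circ> transpose a b" "\<lambda>h. h \<circ> transpose a b"])
      (use s in \<open>auto simp: comp_assoc intro: permutes_compose\<close>)
  also have "\<dots> = (\<Sum>h | h permutes X. - tabloid_act h ?e)"
    by (intro sum.cong refl) (use s in \<open>auto simp: tabloid_act_comp[symmetric] neg tabloid_act_uminus\<close>)
  finally have "?S = - ?S" by (simp only: sum_negf)
  then have "?S = 0" by (simp add: fun_eq_iff)
  then have "fscale c ?S + (\<Sum>h | h permutes X. tabloid_act h v) = 0"
    using add.IH by (simp only: fun_vs.scale_zero_right add_0)
  then show ?case
    by (simp only: tabloid_act_add tabloid_act_fscale sum.distrib fun_vs.scale_sum_right)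
qed

section \<open>Deleting the first row\<close>

text \<open>Only tabloids with first row \<open>K\<close> count, and their first row is deleted.  When \<open>K\<close> consists of
  the \<open>l\<close> largest entries, this maps the Specht module of \<open>l # mu\<close> onto that of \<open>mu\<close>.\<close>

definition drop_first_row :: "nat set \<Rightarrow> (tabloid \<Rightarrow> complex) \<Rightarrow> tabloid \<Rightarrow> complex" where
  "drop_first_row K x = (\<lambda>T. x (case_nat K T))"

lemma drop_first_row_add: "drop_first_row K (x + y) = drop_first_row K x + drop_first_row K y"
  by (simp add: drop_first_row_def fun_eq_iff)

lemma drop_first_row_diff: "drop_first_row K (x - y) = drop_first_row K x - drop_first_row K y"
  by (simp add: drop_first_row_def fun_eq_iff)

lemma drop_first_row_fscale: "drop_first_row K (fscale c x) = fscale c (drop_first_row K x)"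
  by (simp add: drop_first_row_def fscale_def)

lemma drop_first_row_zero: "drop_first_row K 0 = 0"
  by (simp add: drop_first_row_def fun_eq_iff)

lemma drop_first_row_sum: "drop_first_row K (\<Sum>a\<in>S. g a) = (\<Sum>a\<in>S. drop_first_row K (g a))"
  by (simp add: drop_first_row_def fun_eq_iff sum_fun_apply)

lemma case_nat_eq_iff: "case_nat a f = case_nat b g \<longleftrightarrow> a = b \<and> f = g"
proof
  assume "case_nat a f = case_nat b g"
  then have "case_nat a f i = case_nat b g i" for i by simp
  from this[of 0] this[of "Suc _"] show "a = b \<and> f = g" by auto
qed auto

lemma cells_Cons: "cells (l # mu) = Pair 0 ` {..<l} \<union> map_prod Suc id ` cells mu"
proof -
  have "c \<in> cells (l # mu) \<longleftrightarrow> c \<in> Pair 0 ` {..<l} \<union> map_prod Suc id ` cells mu" for c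
    by (cases c; cases "fst c") (auto simp: cells_def image_iff)
  then show ?thesis by blast
qed

lemma tabloid_Cons:
  "tabloid (l # mu) t = case_nat (t ` Pair 0 ` {..<l}) (tabloid mu (t \<circ> map_prod Suc id))"
proof
  fix i
  have "{c \<in> cells (l # mu). fst c = Suc k} = map_prod Suc id ` {c \<in> cells mu. fst c = k}" for k
    by (auto simp: cells_Cons)
  then show "tabloid (l # mu) t i =
      case_nat (t ` Pair 0 ` {..<l}) (tabloid mu (t \<circ> map_prod Suc id)) i"
    by (cases i) (simp_all add: tabloid_def cells_Cons_first_row image_comp)
qed

context
  fixes l :: nat and mu :: "nat list" and t :: tableau
  assumes t: "tableau_of (l # mu) t"
    and row: "t ` Pair 0 ` {..<l} = {sum_list mu..<l + sum_list mu}"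
begin

text \<open>In this context the first row of \<open>t\<close> consists of the largest entries, so that the remaining
  rows, moved up by one, form a tableau \<open>t \<circ> map_prod Suc id\<close> of shape \<open>mu\<close>.\<close>

lemma lower_rows_image: "(t \<circ> map_prod Suc id) ` {c \<in> cells mu. P (snd c)} =
    t ` {c \<in> cells (l # mu). P (snd c)} - {sum_list mu..<l + sum_list mu}"
proof -
  have inj: "inj_on t (cells (l # mu))" using t by (auto simp: tableau_of_def bij_betw_def)
  have "t ` {c \<in> cells (l # mu). P (snd c)} - t ` Pair 0 ` {..<l} =
      t ` ({c \<in> cells (l # mu). P (snd c)} - Pair 0 ` {..<l})"
    by (rule inj_on_image_set_diff[OF inj, symmetric]) (auto simp: cells_Cons)
  also have "{c \<in> cells (l # mu). P (snd c)} - Pair 0 ` {..<l} =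
      map_prod Suc id ` {c \<in> cells mu. P (snd c)}"
    by (auto simp: cells_Cons)
  finally show ?thesis unfolding row by (simp only: image_comp)
qed

lemma tableau_of_lower_rows: "tableau_of mu (t \<circ> map_prod Suc id)"
proof -
  have inj: "inj_on t (cells (l # mu))" and img: "t ` cells (l # mu) = {..<l + sum_list mu}"
    using t by (auto simp: tableau_of_def bij_betw_def)
  have "(t \<circ> map_prod Suc id) ` cells mu = {..<sum_list mu}"
    using lower_rows_image[of "\<lambda>_. True"] img by auto
  moreover have "inj_on (t \<circ> map_prod Suc id) (cells mu)"
    by (intro comp_inj_on inj_on_subset[OF inj]) (auto simp: inj_on_def cells_Cons)
  ultimately show ?thesis by (simp add: tableau_of_def bij_betw_def)
qed

text \<open>A column permutation of \<open>t\<close> that maps the set of first row entries to itself fixes each of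
  them, because every column contains exactly one.  It therefore acts on the lower rows only.\<close>

lemma col_stabilizer_lower_rows:
  "col_stabilizer mu (t \<circ> map_prod Suc id) =
   {q \<in> col_stabilizer (l # mu) t. q ` {sum_list mu..<l + sum_list mu} = {sum_list mu..<l + sum_list mu}}"
  (is "?L = {q \<in> ?C. q ` ?K = ?K}")
proof (intro equalityI subsetI)
  let ?n = "sum_list mu"
  let ?col = "\<lambda>j. t ` {c \<in> cells (l # mu). snd c = j}"
  have low: "(t \<circ> map_prod Suc id) ` {c \<in> cells mu. snd c = j} = ?col j - ?K" for j
    by (rule lower_rows_image)
  {
    fix q assume "q \<in> ?L"
    then have q: "q permutes {..<?n}" and col: "q ` (?col j - ?K) = ?col j - ?K" for j
      unfolding col_stabilizer_def low by auto
    have fix_K: "q k = k" if "k \<in> ?K" for k using permutes_not_in[OF q] that by simp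
    then have im: "q ` X = X" if "X \<subseteq> ?K" for X using that by force
    have "q ` ?col j = ?col j" for j
    proof -
      have "q ` ?col j = q ` (?col j - ?K) \<union> q ` (?col j \<inter> ?K)" by blast
      also have "\<dots> = ?col j" using col im[of "?col j \<inter> ?K"] by auto
      finally show ?thesis .
    qed
    moreover have "q permutes {..<l + ?n}" by (rule permutes_subset[OF q]) simp
    ultimately show "q \<in> {q \<in> ?C. q ` ?K = ?K}" using im[of ?K] by (simp add: col_stabilizer_def)
  next
    fix q assume q: "q \<in> {q \<in> ?C. q ` ?K = ?K}"
    then have perm: "q permutes {..<l + ?n}" and col: "q ` ?col j = ?col j" and K: "q ` ?K = ?K" for j
      by (auto simp: col_stabilizer_def)
    have inj: "inj_on t (cells (l # mu))" using t by (auto simp: tableau_of_def bij_betw_def)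
    have "q k = k" if k: "k \<in> ?K" for k
    proof -
      obtain j where j: "j < l" "k = t (0, j)" using k row by blast
      then have "k \<in> ?col j" by (auto simp: cells_def)
      then have "q k \<in> ?col j" using col by blast
      moreover have "q k \<in> t ` Pair 0 ` {..<l}" using k K row by blast
      ultimately obtain c j' where "c \<in> cells (l # mu)" "snd c = j" "q k = t c"
        "j' < l" "q k = t (0, j')" by auto
      moreover from this have "c = (0, j')" using inj by (auto simp: cells_Cons dest: inj_onD)
      ultimately show ?thesis using j by simp
    qed
    then have "q permutes {..<?n}" by (intro permutes_superset[OF perm]) auto
    moreover have "q ` (?col j - ?K) = ?col j - ?K" for j
      using image_set_diff[OF permutes_inj[OF perm], of "?col j" ?K] col K by simp
    ultimately show "q \<in> ?L" unfolding col_stabilizer_def low by simp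
  }
qed

text \<open>The terms of the polytabloid that survive are those of the column permutations keeping the
  first row, which are the column permutations of the lower rows.\<close>

lemma drop_first_row_polytabloid:
  "drop_first_row {sum_list mu..<l + sum_list mu} (polytabloid (l # mu) t) =
    polytabloid mu (t \<circ> map_prod Suc id)"
proof
  fix T
  let ?K = "{sum_list mu..<l + sum_list mu}" and ?s = "t \<circ> map_prod Suc id"
  let ?C = "col_stabilizer (l # mu) t"
  have fin: "finite ?C"
    by (rule finite_subset[OF _ finite_permutations[of "{..<sum_list (l # mu)}"]])
      (auto simp: col_stabilizer_def)
  have eq: "case_nat ?K T = tabloid (l # mu) (q \<circ> t) \<longleftrightarrow> q ` ?K = ?K \<and> T = tabloid mu (q \<circ> ?s)" for q
    unfolding tabloid_Cons case_nat_eq_iff image_comp[symmetric] row comp_assoc by auto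
  have "drop_first_row ?K (polytabloid (l # mu) t) T =
      (\<Sum>q\<in>?C. of_int (sign q) * of_bool (q ` ?K = ?K \<and> T = tabloid mu (q \<circ> ?s)))"
    by (simp add: drop_first_row_def polytabloid_def eq)
  also have "\<dots> = (\<Sum>q\<in>?C. if q ` ?K = ?K then of_int (sign q) * of_bool (T = tabloid mu (q \<circ> ?s)) else 0)"
    by (intro sum.cong) auto
  also have "\<dots> = (\<Sum>q\<in>col_stabilizer mu ?s. of_int (sign q) * of_bool (T = tabloid mu (q \<circ> ?s)))"
    unfolding col_stabilizer_lower_rows by (rule sum.inter_filter[OF fin, symmetric])
  finally show "drop_first_row ?K (polytabloid (l # mu) t) T = polytabloid mu ?s T"
    by (simp add: polytabloid_def)
qed

end

text \<open>A polytabloid is killed unless some column permutation \<open>q\<close> brings the largest entries into the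
  first row.  In that case, up to a sign, \<open>t\<close> may be replaced by \<open>q \<circ> t\<close>.\<close>

lemma drop_first_row_specht:
  assumes "x \<in> specht (l # mu)"
  shows "drop_first_row {sum_list mu..<l + sum_list mu} x \<in> specht mu"
  using assms
proof (induction rule: specht_induct)
  case zero
  then show ?case using fun_vs.subspace_0[OF subspace_specht] by (simp only: drop_first_row_zero)
next
  case (add c t v)
  let ?K = "{sum_list mu..<l + sum_list mu}" and ?e = "polytabloid (l # mu) t"
  have "drop_first_row ?K ?e \<in> specht mu"
  proof (cases "\<exists>q\<in>col_stabilizer (l # mu) t. (q \<circ> t) ` Pair 0 ` {..<l} = ?K")
    case True
    then obtain q where q: "q \<in> col_stabilizer (l # mu) t" and row: "(q \<circ> t) ` Pair 0 ` {..<l} = ?K"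
      by blast
    have perm: "q permutes {..<sum_list (l # mu)}" by (rule col_stabilizer_permutes[OF q])
    have qt: "tableau_of (l # mu) (q \<circ> t)" by (rule tableau_of_comp[OF add(1) perm])
    have "polytabloid (l # mu) (q \<circ> t) = fscale (of_int (sign q)) ?e"
      using tabloid_act_col_stabilizer[OF q] tabloid_act_polytabloid[OF perm] by simp
    then have "fscale (of_int (sign q)) (polytabloid (l # mu) (q \<circ> t)) = ?e"
      by (simp add: fscale_def fun_eq_iff sign_def)
    moreover have "drop_first_row ?K (fscale (of_int (sign q)) (polytabloid (l # mu) (q \<circ> t))) \<in> specht mu"
      unfolding drop_first_row_fscale drop_first_row_polytabloid[OF qt row]
      by (intro fun_vs.subspace_scale subspace_specht polytabloid_in_specht tableau_of_lower_rows[OF qt row])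
    ultimately show ?thesis by simp
  next
    case False
    then have "?e (case_nat ?K T) = 0" for T
      unfolding polytabloid_def tabloid_Cons case_nat_eq_iff by (intro sum.neutral) auto
    then have "drop_first_row ?K ?e = 0" by (simp add: drop_first_row_def fun_eq_iff)
    then show ?thesis using fun_vs.subspace_0[OF subspace_specht] by simp
  qed
  then have "fscale c (drop_first_row ?K ?e) + drop_first_row ?K v \<in> specht mu"
    using add.IH by (intro fun_vs.subspace_add fun_vs.subspace_scale subspace_specht)
  then show ?case by (simp only: drop_first_row_add drop_first_row_fscale)
qed

text \<open>A tableau \<open>s\<close> of shape \<open>mu\<close> is extended by a first row of the largest entries.\<close>

lemma drop_first_row_surj:
  assumes "y \<in> specht mu"
  shows "\<exists>x\<in>specht (l # mu). drop_first_row {sum_list mu..<l + sum_list mu} x = y"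
  using assms
proof (induction rule: specht_induct)
  case zero
  then show ?case using fun_vs.subspace_0[OF subspace_specht] drop_first_row_zero by blast
next
  case (add c s v)
  let ?n = "sum_list mu"
  let ?K = "{?n..<l + ?n}"
  define t where "t = (\<lambda>(i, j). case i of 0 \<Rightarrow> ?n + j | Suc k \<Rightarrow> s (k, j))"
  have st: "t \<circ> map_prod Suc id = s" by (auto simp: t_def)
  have row: "t ` Pair 0 ` {..<l} = ?K"
  proof -
    have "(+) ?n ` {..<l} = ?K"
      using image_add_atLeastLessThan[of ?n 0 l] by (simp add: lessThan_atLeast0 add.commute)
    then show ?thesis by (simp add: t_def image_image)
  qed
  have s: "inj_on s (cells mu)" "s ` cells mu = {..<?n}"
    using add(1) by (auto simp: tableau_of_def bij_betw_def)
  have low: "t ` map_prod Suc id ` cells mu = {..<?n}" using s st by (metis image_comp)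
  have "inj_on t (cells (l # mu))"
    unfolding cells_Cons inj_on_Un
  proof (intro conjI)
    show "inj_on t (Pair 0 ` {..<l})" by (auto simp: inj_on_def t_def)
    show "inj_on t (map_prod Suc id ` cells mu)" using s(1) by (auto simp: inj_on_def t_def)
    have "t ` A \<inter> t ` B = {}" if "A \<subseteq> Pair 0 ` {..<l}" "B \<subseteq> map_prod Suc id ` cells mu" for A B
    proof -
      have "t ` A \<subseteq> ?K" "t ` B \<subseteq> {..<?n}" using that row low by blast+
      then show ?thesis by fastforce
    qed
    then show "t ` (Pair 0 ` {..<l} - map_prod Suc id ` cells mu) \<inter>
      t ` (map_prod Suc id ` cells mu - Pair 0 ` {..<l}) = {}" by blast
  qed
  moreover have "t ` cells (l # mu) = {..<l + ?n}"
    unfolding cells_Cons image_Un row low by auto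
  ultimately have t: "tableau_of (l # mu) t" by (simp add: tableau_of_def bij_betw_def)
  from add.IH obtain x where x: "x \<in> specht (l # mu)" "drop_first_row ?K x = v" by blast
  have "drop_first_row ?K (fscale c (polytabloid (l # mu) t) + x) = fscale c (polytabloid mu s) + v"
    using drop_first_row_polytabloid[OF t row] st x(2)
    by (simp only: drop_first_row_add drop_first_row_fscale)
  moreover have "fscale c (polytabloid (l # mu) t) + x \<in> specht (l # mu)"
    using x(1) by (intro fun_vs.subspace_add fun_vs.subspace_scale subspace_specht polytabloid_in_specht t)
  ultimately show ?case by blast
qed

text \<open>Elements of the Specht module are functions of arbitrary sequences of sets; they are supported
  on those that are the rows of a tableau.\<close>

lemma specht_support:
  assumes "x \<in> specht lam" "x T \<noteq> 0"
  obtains t where "tableau_of lam t" "T = tabloid lam t"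
proof -
  have "x T \<noteq> 0 \<longrightarrow> (\<exists>t. tableau_of lam t \<and> T = tabloid lam t)"
    using assms(1)
  proof (induction rule: specht_induct)
    case (add c t v)
    show ?case
    proof
      assume nz: "(fscale c (polytabloid lam t) + v) T \<noteq> 0"
      show "\<exists>t. tableau_of lam t \<and> T = tabloid lam t"
      proof (cases "v T = 0")
        case True
        with nz have "polytabloid lam t T \<noteq> 0" by (simp add: fscale_def)
        then obtain q where "q \<in> col_stabilizer lam t" "T = tabloid lam (q \<circ> t)"
          unfolding polytabloid_def by (rule sum.not_neutral_contains_not_neutral) auto
        then show ?thesis using tableau_of_comp[OF add(1) col_stabilizer_permutes] by blast
      qed (use add.IH in blast)
    qed
  qed simp
  then show thesis using assms(2) that by blast
qed

lemma tabloid_disjoint_rows: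
  assumes "tableau_of lam t" "i \<noteq> j"
  shows "tabloid lam t i \<inter> tabloid lam t j = {}"
proof -
  have "inj_on t (cells lam)" using assms(1) by (simp add: tableau_of_def bij_betw_def)
  then have "t ` {c \<in> cells lam. fst c = i} \<inter> t ` {c \<in> cells lam. fst c = j} =
      t ` ({c \<in> cells lam. fst c = i} \<inter> {c \<in> cells lam. fst c = j})"
    by (intro inj_on_image_Int[symmetric]) auto
  also have "{c \<in> cells lam. fst c = i} \<inter> {c \<in> cells lam. fst c = j} = {}" using assms(2) by auto
  finally show ?thesis by (simp add: tabloid_def)
qed

lemma tabloid_subset:
  assumes "tableau_of lam t"
  shows "tabloid lam t i \<subseteq> {..<sum_list lam}"
  using assms by (auto simp: tabloid_def tableau_of_def bij_betw_def)

lemma card_tabloid_first_row: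
  assumes "tableau_of (l # mu) t"
  shows "card (tabloid (l # mu) t 0) = l"
proof -
  have "inj_on t (Pair 0 ` {..<l})"
    using assms by (auto simp: tableau_of_def bij_betw_def cells_Cons intro: inj_on_subset)
  then show ?thesis by (simp add: tabloid_Cons card_image inj_on_def)
qed

lemma drop_first_row_lower_act:
  assumes \<sigma>: "\<sigma> permutes {..<n}"
  shows "drop_first_row {n..<r} (tabloid_act \<sigma> x) = tabloid_act \<sigma> (drop_first_row {n..<r} x)"
proof
  fix T
  have "Hilbert_Choice.inv \<sigma> ` {n..<r} = {n..<r}"
    using permutes_not_in[OF permutes_inv[OF \<sigma>]] by force
  then have "(\<lambda>i. Hilbert_Choice.inv \<sigma> ` case_nat {n..<r} T i) =
      case_nat {n..<r} (\<lambda>i. Hilbert_Choice.inv \<sigma> ` T i)"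
    by (auto simp: fun_eq_iff split: nat.split)
  then show "drop_first_row {n..<r} (tabloid_act \<sigma> x) T =
      tabloid_act \<sigma> (drop_first_row {n..<r} x) T"
    by (simp add: drop_first_row_def tabloid_act_def)
qed

text \<open>A permutation of the largest entries changes neither the set \<open>K\<close> nor any row that consists of
  smaller entries, and \<open>drop_first_row K x\<close> is supported on sequences of such rows.\<close>

lemma drop_first_row_upper_act:
  fixes l :: nat and mu :: "nat list"
  defines "K \<equiv> {sum_list mu..<l + sum_list mu}"
  assumes x: "x \<in> specht (l # mu)" and h: "h permutes K"
  shows "drop_first_row K (tabloid_act h x) = drop_first_row K x"
proof
  fix T
  let ?i = "Hilbert_Choice.inv h"
  have i: "?i permutes K" by (rule permutes_inv[OF h])
  show "drop_first_row K (tabloid_act h x) T = drop_first_row K x T"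
  proof (cases "\<forall>i. T i \<subseteq> {..<sum_list mu}")
    case True
    have "?i ` T i = T i" for i
    proof -
      have "?i k = id k" if "k \<in> T i" for k
      proof -
        have "k \<notin> K" using True that by (fastforce simp: K_def)
        then show ?thesis using permutes_not_in[OF i] by simp
      qed
      then show ?thesis by (simp cong: image_cong)
    qed
    then have "(\<lambda>i. ?i ` case_nat K T i) = case_nat K T"
      using permutes_image[OF i] by (auto simp: fun_eq_iff split: nat.split)
    then show ?thesis by (simp add: drop_first_row_def tabloid_act_def)
  next
    case False
    have z: "y T = 0" if "y \<in> specht mu" for y
      using specht_support[OF that, of T] tabloid_subset[of mu] False by metis
    have "h permutes {..<sum_list (l # mu)}" by (rule permutes_subset[OF h]) (auto simp: K_def)
    then have "tabloid_act h x \<in> specht (l # mu)" using x tabloid_act_specht by blast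
    then have "drop_first_row K (tabloid_act h x) T = 0" "drop_first_row K x T = 0"
      using x unfolding K_def by (blast intro: z drop_first_row_specht)+
    then show ?thesis by simp
  qed
qed

text \<open>Among the elements invariant under all permutations of \<open>K\<close>, an element \<open>x\<close> is determined by its
  values on tabloids with first row \<open>K\<close>.  Indeed, for an entry \<open>a \<notin> K\<close>, symmetrizing over \<open>insert a K\<close>, which has
  \<open>l + 1\<close> elements, gives \<open>\<Sum>\<^sub>b (a b) x = 0\<close>, where \<open>b\<close> ranges over \<open>insert a K\<close>.  Evaluate this at a
  tabloid \<open>T\<close> with \<open>a\<close> in its first row: if \<open>b\<close> is in the first row too, the term is \<open>x T\<close>; otherwise
  it is the value of \<open>x\<close> at a tabloid that has more entries from \<open>K\<close> in its first row.  So \<open>x T\<close> is a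
  combination of such values, and induction applies.\<close>

lemma invariant_eq_0_if_drop_first_row_eq_0:
  fixes l :: nat and mu :: "nat list"
  defines "K \<equiv> {sum_list mu..<l + sum_list mu}"
  assumes part: "partition_of r (l # mu)" and x: "x \<in> specht (l # mu)"
    and inv: "\<And>h. h permutes K \<Longrightarrow> tabloid_act h x = x"
    and drop: "drop_first_row K x = 0"
  shows "x = 0"
proof -
  let ?n = "sum_list mu"
  have r: "r = l + ?n" using part by (simp add: partition_of_def)
  have finK: "finite K" by (simp add: K_def)
  have cardK: "card K = l" by (simp add: K_def)
  \<comment> \<open>Every permutation of \<open>insert a K\<close> is some \<open>(a b)\<close> after a permutation of \<open>K\<close>, and the latter fixes \<open>x\<close>.\<close>
  have rel: "(\<Sum>b\<in>insert a K. tabloid_act (transpose a b) x) = 0" if a: "a < ?n" for a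
  proof -
    have aK: "a \<notin> K" using a by (simp add: K_def)
    have "0 = (\<Sum>h | h permutes insert a K. tabloid_act h x)"
      by (rule symmetrizer_eq_0[OF part x, symmetric]) (use a finK aK cardK in \<open>auto simp: K_def r\<close>)
    also have "\<dots> = (\<Sum>b\<in>insert a K. \<Sum>q | q permutes K. tabloid_act (transpose a b \<circ> q) x)"
      by (rule sum_over_permutations_insert[OF finK aK])
    also have "\<dots> = (\<Sum>b\<in>insert a K. \<Sum>q | q permutes K. tabloid_act (transpose a b) x)"
    proof (intro sum.cong refl)
      fix b q assume b: "b \<in> insert a K" and q: "q \<in> {q. q permutes K}"
      have "transpose a b permutes insert a K" using b by (intro permutes_swap_id) auto
      moreover have "q permutes insert a K" using q by (auto intro: permutes_subset)
      ultimately show "tabloid_act (transpose a b \<circ> q) x = tabloid_act (transpose a b) x"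
        using inv q by (simp flip: tabloid_act_comp)
    qed
    also have "\<dots> = fscale (of_nat (fact l :: nat)) (\<Sum>b\<in>insert a K. tabloid_act (transpose a b) x)"
      unfolding fun_eq_iff fscale_def sum_fun_apply
      by (simp add: sum_distrib_left card_permutations[OF cardK finK])
    finally show ?thesis by (simp add: fun_eq_iff fscale_def)
  qed
  have "x T = 0" for T
  proof (induction "card (T 0 - K)" arbitrary: T rule: less_induct)
    case less
    show ?case
    proof (rule ccontr)
      assume nz: "x T \<noteq> 0"
      then obtain t where t: "tableau_of (l # mu) t" and T: "T = tabloid (l # mu) t"
        using specht_support[OF x] by metis
      have sub: "T i \<subseteq> {..<l + ?n}" for i using tabloid_subset[OF t] T by simp
      have fin: "finite (T 0)" by (rule finite_subset[OF sub]) simp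
      have card0: "card (T 0) = l" using card_tabloid_first_row[OF t] T by simp
      have "T 0 - K \<noteq> {}"
      proof
        assume "T 0 - K = {}"
        then have "T 0 = K" using card_subset_eq[OF finK, of "T 0"] card0 cardK by auto
        then have "T = case_nat K (\<lambda>i. T (Suc i))" by (auto simp: fun_eq_iff split: nat.split)
        then have "x T = drop_first_row K x (\<lambda>i. T (Suc i))" by (metis drop_first_row_def)
        then show False using drop nz by simp
      qed
      then obtain a where a: "a \<in> T 0" "a \<notin> K" by blast
      then have an: "a < ?n" using sub[of 0] by (auto simp: K_def)
      let ?g = "\<lambda>b. x (\<lambda>i. transpose a b ` T i)"
      have "?g b = x T" if "b \<in> T 0" for b
      proof -
        have "a \<in> T i \<longleftrightarrow> b \<in> T i" for i
          using tabloid_disjoint_rows[OF t, of 0 i] that a(1) T by (cases "i = 0") auto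
        then show ?thesis by (simp add: transpose_image_eq)
      qed
      moreover have "?g b = 0" if b: "b \<in> K" "b \<notin> T 0" for b
      proof (rule less)
        have "transpose a b ` T 0 = insert b (T 0 - {a})"
          using a b by (auto simp: transpose_def image_iff)
        then have "transpose a b ` T 0 - K = (T 0 - K) - {a}" using a b by auto
        also have "card \<dots> < card (T 0 - K)"
          using a fin by (intro card_Diff1_less) auto
        finally show "card (transpose a b ` T 0 - K) < card (T 0 - K)" .
      qed
      ultimately have g: "?g b = (if b \<in> T 0 then x T else 0)" if "b \<in> insert a K" for b
        using that a by auto
      have "0 = (\<Sum>b\<in>insert a K. tabloid_act (transpose a b) x) T" using rel[OF an] by simp
      also have "\<dots> = (\<Sum>b\<in>insert a K. if b \<in> T 0 then x T else 0)"
        unfolding sum_fun_apply by (intro sum.cong) (simp_all add: tabloid_act_def g)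
      also have "\<dots> = of_nat (card (insert a K \<inter> T 0)) * x T"
        using finK by (simp add: sum.If_cases Int_def)
      \<comment> \<open>The coefficient of \<open>x T\<close> is positive, as \<open>b = a\<close> contributes to it.\<close>
      finally have "card (insert a K \<inter> T 0) = 0" using nz by simp
      then show False using finK a by auto
    qed
  qed
  then show ?thesis by (simp add: fun_eq_iff)
qed

section \<open>Homomorphisms into tensor space\<close>


lemma mult_spaceD:
  assumes "\<phi> \<in> mult_space n r lam"
  shows mult_space_outside: "v \<notin> specht lam \<Longrightarrow> \<phi> v = 0"
    and mult_space_tensor: "v \<in> specht lam \<Longrightarrow> \<phi> v \<in> tensor_space n r"
    and mult_space_add: "v \<in> specht lam \<Longrightarrow> w \<in> specht lam \<Longrightarrow> \<phi> (v + w) = \<phi> v + \<phi> w"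
    and mult_space_fscale: "v \<in> specht lam \<Longrightarrow> \<phi> (fscale c v) = fscale c (\<phi> v)"
    and mult_space_equivariant: "\<sigma> permutes {..<r} \<Longrightarrow> v \<in> specht lam \<Longrightarrow>
      \<phi> (tabloid_act \<sigma> v) = tensor_act \<sigma> (\<phi> v)"
  using assms unfolding mult_space_def by blast+

lemma zero_in_specht: "0 \<in> specht lam"
  by (rule fun_vs.subspace_0[OF subspace_specht])

lemma mult_space_zero: "\<phi> \<in> mult_space n r lam \<Longrightarrow> \<phi> 0 = 0"
  using mult_space_fscale[OF _ zero_in_specht, where c = 0] by (simp only: fun_vs.scale_zero_left)

lemma mult_space_sum:
  assumes "\<phi> \<in> mult_space n r lam" "finite S" "\<And>a. a \<in> S \<Longrightarrow> g a \<in> specht lam"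
  shows "\<phi> (\<Sum>a\<in>S. g a) = (\<Sum>a\<in>S. \<phi> (g a))"
  using assms(2,3)
proof (induction S rule: finite_induct)
  case empty
  then show ?case by (simp only: sum.empty mult_space_zero[OF assms(1)])
next
  case (insert a S)
  then have "sum g S \<in> specht lam" by (intro fun_vs.subspace_sum[OF subspace_specht]) auto
  then have "\<phi> (g a + sum g S) = \<phi> (g a) + \<phi> (sum g S)"
    using insert by (intro mult_space_add[OF assms(1)]) auto
  moreover have "\<phi> (sum g S) = (\<Sum>a\<in>S. \<phi> (g a))" using insert by simp
  ultimately show ?case by (simp only: sum.insert[OF insert.hyps])
qed

lemma mult_space_eval_map:
  assumes "\<phi> \<in> mult_space n r lam" "p permutes {..<r}" "v \<in> specht lam"
  shows "\<phi> v (map p js) = \<phi> (tabloid_act (Hilbert_Choice.inv p) v) js"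
  using mult_space_equivariant[OF assms(1) permutes_inv[OF assms(2)] assms(3)]
  by (simp add: tensor_act_def permutes_inv_inv[OF assms(2)])

lemma subspace_mult_space: "hom_vs.subspace (mult_space n r lam)"
proof (rule hom_vs.subspaceI)
  show "0 \<in> mult_space n r lam"
    by (auto simp: mult_space_def tensor_space_def fscale_def tensor_act_def fun_eq_iff)
next
  fix \<phi> \<psi> assume m: "\<phi> \<in> mult_space n r lam" "\<psi> \<in> mult_space n r lam"
  show "\<phi> + \<psi> \<in> mult_space n r lam"
    unfolding mult_space_def mem_Collect_eq
  proof (intro conjI allI ballI impI)
    fix v assume "v \<in> specht lam"
    then show "(\<phi> + \<psi>) v \<in> tensor_space n r"
      using mult_space_tensor[OF m(1), of v] mult_space_tensor[OF m(2), of v]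
      by (simp add: tensor_space_def)
  qed (simp_all add: mult_spaceD[OF m(1)] mult_spaceD[OF m(2)] fun_vs.scale_right_distrib
      tensor_act_def fun_eq_iff)
next
  fix c \<phi> assume m: "\<phi> \<in> mult_space n r lam"
  show "hscale c \<phi> \<in> mult_space n r lam"
    unfolding mult_space_def mem_Collect_eq
  proof (intro conjI allI ballI impI)
    fix v assume "v \<in> specht lam"
    then show "hscale c \<phi> v \<in> tensor_space n r"
      using mult_space_tensor[OF m, of v] by (simp add: tensor_space_def hscale_def fscale_def)
    fix a show "hscale c \<phi> (fscale a v) = fscale a (hscale c \<phi> v)" if "v \<in> specht lam" for v
      using that by (simp only: hscale_def mult_space_fscale[OF m] fun_vs.scale_left_commute)
  qed (simp_all add: mult_spaceD[OF m] hscale_def fscale_def tensor_act_def fun_eq_iff algebra_simps)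
qed

text \<open>A transposition of two elements of \<open>X\<close> negates each polytabloid \<open>e\<close> by pigeonhole, and it does
  not affect the coefficient of \<open>\<phi> e\<close> at \<open>js\<close> by assumption; so that coefficient is its own negative.\<close>

lemma eval_0_if_swaps_fix:
  assumes part: "partition_of r (l # mu)" and m: "\<phi> \<in> mult_space n r (l # mu)"
    and X: "X \<subseteq> {..<r}" "card X > l"
    and fixed: "\<And>a b v. a \<in> X \<Longrightarrow> b \<in> X \<Longrightarrow> v \<in> specht (l # mu) \<Longrightarrow>
      \<phi> v (map (transpose a b) js) = \<phi> v js"
    and v: "v \<in> specht (l # mu)"
  shows "\<phi> v js = 0"
  using v
proof (induction rule: specht_induct)
  case zero
  then show ?case by (subst mult_space_zero[OF m]) (rule zero_fun_apply)
next
  case (add c t v)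
  let ?e = "polytabloid (l # mu) t"
  obtain a b where ab: "a \<in> X" "b \<in> X" "a \<noteq> b" "tabloid_act (transpose a b) ?e = - ?e"
    using exists_transpose_negating_polytabloid[OF part add(1) X] by metis
  have e: "?e \<in> specht (l # mu)" by (rule polytabloid_in_specht[OF add(1)])
  have perm: "transpose a b permutes {..<r}" using ab X(1) by (intro permutes_swap_id) auto
  have "\<phi> ?e js = \<phi> ?e (map (transpose a b) js)" using fixed[OF ab(1,2) e] by simp
  also have "\<dots> = \<phi> (- ?e) js" using mult_space_eval_map[OF m perm e] ab(4) by simp
  also have "- ?e = fscale (-1) ?e" by (simp add: fscale_def fun_eq_iff)
  also have "\<phi> (fscale (-1) ?e) js = - \<phi> ?e js"
    by (simp only: mult_space_fscale[OF m e]) (simp add: fscale_def)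
  finally have "\<phi> ?e js = 0" by simp
  then have "(fscale c (\<phi> ?e) + \<phi> v) js = 0" using add.IH by (simp add: fscale_def)
  then show ?case
    by (simp only: mult_space_add[OF m fun_vs.subspace_scale[OF subspace_specht e] add(2)]
      mult_space_fscale[OF m e])
qed

text \<open>With \<open>n = |mu|\<close>, a multi-index with a repeated value leaves more than \<open>l = r - n\<close> values unused,
  and transposing two unused values does not change it.\<close>

lemma mult_space_support:
  assumes part: "partition_of r (l # mu)" and m: "\<phi> \<in> mult_space (sum_list mu) r (l # mu)"
    and nz: "\<phi> v js \<noteq> 0"
  shows "v \<in> specht (l # mu)" "js \<in> multi_indices (sum_list mu) r" "distinct js"
proof -
  show v: "v \<in> specht (l # mu)" using mult_space_outside[OF m, of v] nz by force
  show js: "js \<in> multi_indices (sum_list mu) r"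
    using mult_space_tensor[OF m v] nz by (auto simp: tensor_space_def)
  show "distinct js"
  proof (rule ccontr)
    assume "\<not> distinct js"
    then have "card (set js) < length js" using card_distinct card_length le_neq_implies_less by blast
    moreover have "length js = sum_list mu" "set js \<subseteq> {..<r}" using js by (auto simp: multi_indices_def)
    moreover have "r = l + sum_list mu" using part by (simp add: partition_of_def)
    ultimately have "card ({..<r} - set js) > l" by (simp add: card_Diff_subset)
    moreover have "map (transpose a b) js = js" if "a \<in> {..<r} - set js" "b \<in> {..<r} - set js" for a b
      using that by (intro map_idI) (auto simp: transpose_def)
    ultimately have "\<phi> v js = 0"
      by (intro eval_0_if_swaps_fix[OF part m, of "{..<r} - set js"] v) auto
    then show False using nz by simp
  qed
qed

text \<open>The multi-index \<open>[0..<n]\<close> is fixed by all permutations of \<open>K = {n..<r}\<close>, so averaging \<open>v\<close> over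
  these does not change the coefficient in question.  The average is invariant and still killed by
  deletion of the first row, hence zero.\<close>

lemma mult_space_eval_0_if_drop_first_row_eq_0:
  fixes l :: nat and mu :: "nat list"
  defines "n \<equiv> sum_list mu"
  assumes part: "partition_of r (l # mu)" and m: "\<phi> \<in> mult_space n r (l # mu)"
    and v: "v \<in> specht (l # mu)" and drop: "drop_first_row {n..<r} v = 0"
  shows "\<phi> v [0..<n] = 0"
proof -
  have r: "r = l + n" "sum_list (l # mu) = r" using part by (auto simp: partition_of_def n_def)
  let ?K = "{n..<r}"
  let ?H = "{h. h permutes ?K}"
  have perm: "h permutes {..<r}" if "h permutes ?K" for h by (rule permutes_subset[OF that]) auto
  have hv: "tabloid_act h v \<in> specht (l # mu)" if "h \<in> ?H" for h
    using that perm v tabloid_act_specht[of h "l # mu"] r by simp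
  have fin: "finite ?H" by (rule finite_permutations) simp
  define x where "x = (\<Sum>h\<in>?H. tabloid_act h v)"
  have "x = 0"
  proof (rule invariant_eq_0_if_drop_first_row_eq_0[OF part])
    show "x \<in> specht (l # mu)" unfolding x_def by (rule fun_vs.subspace_sum[OF subspace_specht hv])
    show "tabloid_act g x = x" if "g permutes {sum_list mu..<l + sum_list mu}" for g
    proof -
      have g: "g permutes ?K" using that r by (simp add: n_def)
      have "tabloid_act g x = (\<Sum>h\<in>?H. tabloid_act (g \<circ> h) v)"
        unfolding x_def tabloid_act_sum by (intro sum.cong refl) (simp add: tabloid_act_comp[OF g])
      also have "\<dots> = x"
        unfolding x_def
        by (rule sum.reindex_bij_witness[of _ "\<lambda>h. Hilbert_Choice.inv g \<circ> h" "\<lambda>h. g \<circ> h"])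
          (use g permutes_inv_o[OF g] permutes_inv[OF g] in \<open>auto simp: o_assoc intro: permutes_compose\<close>)
      finally show ?thesis .
    qed
    have "drop_first_row ?K (tabloid_act h v) = 0" if "h \<in> ?H" for h
      using drop_first_row_upper_act[OF v, of h] that drop r by (simp add: n_def)
    then have "drop_first_row ?K x = 0"
      unfolding x_def drop_first_row_sum by (intro sum.neutral) auto
    then show "drop_first_row {sum_list mu..<l + sum_list mu} x = 0" using r by (simp add: n_def)
  qed
  have "\<phi> (tabloid_act h v) [0..<n] = \<phi> v [0..<n]" if "h \<in> ?H" for h
  proof -
    have "map (Hilbert_Choice.inv h) [0..<n] = [0..<n]"
      using that permutes_not_in[OF permutes_inv, of h ?K] by (intro map_idI) auto
    then show ?thesis using mult_space_equivariant[OF m perm v, of h] that by (simp add: tensor_act_def)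
  qed
  then have "(\<Sum>h\<in>?H. \<phi> (tabloid_act h v)) [0..<n] = of_nat (card ?H) * \<phi> v [0..<n]"
    by (simp add: sum_fun_apply)
  moreover have "(\<Sum>h\<in>?H. \<phi> (tabloid_act h v)) = \<phi> x"
    unfolding x_def by (rule mult_space_sum[OF m fin hv, symmetric])
  ultimately have "of_nat (card ?H) * \<phi> v [0..<n] = 0"
    using \<open>x = 0\<close> mult_space_zero[OF m] by simp
  moreover have "card ?H \<noteq> 0" using card_permutations[of ?K l] r by simp
  ultimately show ?thesis by simp
qed

lemma exists_permutes_map_upt:
  assumes "js \<in> multi_indices n r" "distinct js"
  shows "\<exists>p. p permutes {..<r} \<and> map p [0..<n] = js"
proof -
  have js: "set js \<subseteq> {..<r}" "length js = n" using assms by (auto simp: multi_indices_def)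
  then have n: "n \<le> r" using distinct_card[OF assms(2)] card_mono[of "{..<r}" "set js"] by simp
  have "card {n..<r} = card ({..<r} - set js)"
    using js distinct_card[OF assms(2)] by (simp add: card_Diff_subset)
  then obtain g where g: "bij_betw g {n..<r} ({..<r} - set js)"
    using finite_same_card_bij[of "{n..<r}" "{..<r} - set js"] by auto
  define p where "p = (\<lambda>x. if x < n then js ! x else if x < r then g x else x)"
  have "bij_betw p {..<n} (set js)"
    using bij_betw_nth[OF assms(2), of "{..<n}" "set js"] js
    by (subst bij_betw_cong[of _ _ "(!) js"]) (auto simp: p_def)
  moreover have "bij_betw p {n..<r} ({..<r} - set js)"
    using g by (subst bij_betw_cong[of _ _ g]) (auto simp: p_def)
  ultimately have "bij_betw p ({..<n} \<union> {n..<r}) (set js \<union> ({..<r} - set js))"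
    by (rule bij_betw_combine) auto
  moreover have "{..<n} \<union> {n..<r} = {..<r}" "set js \<union> ({..<r} - set js) = {..<r}" using n js by auto
  ultimately have "p permutes {..<r}"
    using n by (intro bij_imp_permutes) (auto simp: p_def)
  moreover have "map p [0..<n] = js" using js by (intro nth_equalityI) (auto simp: p_def)
  ultimately show ?thesis by blast
qed

text \<open>The homomorphism whose coefficient at \<open>[0..<n]\<close> is the linear functional \<open>f\<close> of the image in the
  smaller Specht module.  Equivariance dictates its coefficients at all other injective multi-indices,
  which are of the form \<open>map p [0..<n]\<close>; the choice of \<open>p\<close> does not matter, as the next lemma shows.\<close>

definition induced_hom ::
  "nat \<Rightarrow> nat \<Rightarrow> nat list \<Rightarrow> ((tabloid \<Rightarrow> complex) \<Rightarrow> complex) \<Rightarrow> (tabloid \<Rightarrow> complex) \<Rightarrow> nat list \<Rightarrow> complex" where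
  "induced_hom n r lam f v js =
    (if v \<in> specht lam \<and> js \<in> multi_indices n r \<and> distinct js
     then f (drop_first_row {n..<r} (tabloid_act
       (Hilbert_Choice.inv (SOME p. p permutes {..<r} \<and> map p [0..<n] = js)) v))
     else 0)"

lemma induced_hom_map:
  fixes l :: nat and mu :: "nat list"
  defines "n \<equiv> sum_list mu"
  assumes part: "partition_of r (l # mu)" and v: "v \<in> specht (l # mu)" and p: "p permutes {..<r}"
  shows "induced_hom n r (l # mu) f v (map p [0..<n]) =
    f (drop_first_row {n..<r} (tabloid_act (Hilbert_Choice.inv p) v))"
proof -
  have r: "r = l + n" "sum_list (l # mu) = r" using part by (auto simp: partition_of_def n_def)
  let ?js = "map p [0..<n]"
  have js: "?js \<in> multi_indices n r" "distinct ?js"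
    using permutes_in_image[OF p] permutes_inj[OF p] r by (auto simp: multi_indices_def distinct_map inj_on_def)
  define q where "q = (SOME p. p permutes {..<r} \<and> map p [0..<n] = ?js)"
  have "\<exists>q. q permutes {..<r} \<and> map q [0..<n] = ?js" using p by blast
  then have *: "q permutes {..<r} \<and> map q [0..<n] = ?js" unfolding q_def by (rule someI_ex)
  then have q: "q permutes {..<r}" by blast
  have qp: "q k = p k" if "k < n" for k using * that by simp
  have i: "Hilbert_Choice.inv p permutes {..<r}" by (rule permutes_inv[OF p])
  \<comment> \<open>Two choices differ by a permutation of the entries that deletion of the first row ignores.\<close>
  define h where "h = Hilbert_Choice.inv q \<circ> p"
  have hr: "h permutes {..<r}" unfolding h_def by (intro permutes_compose permutes_inv p q)
  have "h permutes {n..<r}"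
  proof (rule permutes_superset[OF hr])
    fix k assume "k \<in> {..<r} - {n..<r}"
    then have "k < n" by auto
    then show "h k = k"
      using permutes_inverses(2)[OF q, of k] by (simp add: h_def flip: qp)
  qed
  moreover have ip: "tabloid_act (Hilbert_Choice.inv p) v \<in> specht (l # mu)"
    using tabloid_act_specht[of _ "l # mu"] v i r by simp
  ultimately have "drop_first_row {n..<r} (tabloid_act h (tabloid_act (Hilbert_Choice.inv p) v)) =
      drop_first_row {n..<r} (tabloid_act (Hilbert_Choice.inv p) v)"
    using drop_first_row_upper_act[OF ip] r by (simp add: n_def)
  moreover have "h \<circ> Hilbert_Choice.inv p = Hilbert_Choice.inv q"
    by (simp add: h_def comp_assoc permutes_inv_o[OF p])
  ultimately show ?thesis
    unfolding induced_hom_def q_def[symmetric] using v js by (simp add: tabloid_act_comp[OF hr i])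
qed

lemma induced_hom_in_mult_space:
  fixes l :: nat and mu :: "nat list"
  defines "n \<equiv> sum_list mu"
  assumes part: "partition_of r (l # mu)"
    and f_add: "\<And>x y. x \<in> specht mu \<Longrightarrow> y \<in> specht mu \<Longrightarrow> f (x + y) = f x + f y"
    and f_scale: "\<And>c x. x \<in> specht mu \<Longrightarrow> f (fscale c x) = c * f x"
  shows "induced_hom n r (l # mu) f \<in> mult_space n r (l # mu)"
proof -
  let ?S = "specht (l # mu)" and ?\<phi> = "induced_hom n r (l # mu) f"
  have r: "r = l + n" "sum_list (l # mu) = r" using part by (auto simp: partition_of_def n_def)
  have act: "tabloid_act p v \<in> ?S" if "p permutes {..<r}" "v \<in> ?S" for p v
    using tabloid_act_specht[of p "l # mu" v] that r by simp
  have drop: "drop_first_row {n..<r} v \<in> specht mu" if "v \<in> ?S" for v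
    using drop_first_row_specht[OF that] r by (simp add: n_def)
  have outside: "?\<phi> v js = 0" if "js \<notin> multi_indices n r \<or> \<not> distinct js" for v js
    using that by (auto simp: induced_hom_def)
  note val = induced_hom_map[OF part, folded n_def]
  show ?thesis unfolding mult_space_def mem_Collect_eq
  proof (intro conjI allI ballI impI)
    show "?\<phi> v = 0" if "v \<notin> ?S" for v using that by (simp add: induced_hom_def fun_eq_iff)
    show "?\<phi> v \<in> tensor_space n r" for v using outside by (simp add: tensor_space_def)
    show "?\<phi> (v + w) = ?\<phi> v + ?\<phi> w" if "v \<in> ?S" "w \<in> ?S" for v w
    proof
      fix js show "?\<phi> (v + w) js = (?\<phi> v + ?\<phi> w) js"
      proof (cases "js \<in> multi_indices n r \<and> distinct js")
        case True
        then obtain p where p: "p permutes {..<r}" "js = map p [0..<n]"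
          using exists_permutes_map_upt by metis
        have "v + w \<in> ?S" using that by (rule fun_vs.subspace_add[OF subspace_specht])
        then show ?thesis using that p
          by (simp add: val tabloid_act_add drop_first_row_add f_add drop act permutes_inv)
      qed (simp add: outside)
    qed
    show "?\<phi> (fscale c v) = fscale c (?\<phi> v)" if "v \<in> ?S" for c v
    proof
      fix js show "?\<phi> (fscale c v) js = fscale c (?\<phi> v) js"
      proof (cases "js \<in> multi_indices n r \<and> distinct js")
        case True
        then obtain p where p: "p permutes {..<r}" "js = map p [0..<n]"
          using exists_permutes_map_upt by metis
        have "fscale c v \<in> ?S" using that by (rule fun_vs.subspace_scale[OF subspace_specht])
        then have "?\<phi> (fscale c v) js = c * ?\<phi> v js" using that p
          by (simp add: val tabloid_act_fscale drop_first_row_fscale f_scale drop act permutes_inv)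
        then show ?thesis by (simp add: fscale_def)
      qed (simp add: outside fscale_def)
    qed
    show "?\<phi> (tabloid_act \<sigma> v) = tensor_act \<sigma> (?\<phi> v)" if "\<sigma> permutes {..<r}" "v \<in> ?S" for \<sigma> v
    proof
      fix js
      let ?i = "Hilbert_Choice.inv"
      have i: "?i \<sigma> permutes {..<r}" by (rule permutes_inv[OF that(1)])
      show "?\<phi> (tabloid_act \<sigma> v) js = tensor_act \<sigma> (?\<phi> v) js"
      proof (cases "js \<in> multi_indices n r \<and> distinct js")
        case True
        then obtain p where p: "p permutes {..<r}" "js = map p [0..<n]"
          using exists_permutes_map_upt by metis
        have "?\<phi> (tabloid_act \<sigma> v) js = f (drop_first_row {n..<r} (tabloid_act (?i p \<circ> \<sigma>) v))"
          using p that act by (simp add: val tabloid_act_comp[OF permutes_inv])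
        also have "?i p \<circ> \<sigma> = ?i (?i \<sigma> \<circ> p)"
          using permutes_bij[OF i] permutes_bij[OF p(1)]
          by (simp add: o_inv_distrib permutes_inv_inv[OF that(1)])
        also have "f (drop_first_row {n..<r} (tabloid_act (?i (?i \<sigma> \<circ> p)) v)) =
            ?\<phi> v (map (?i \<sigma> \<circ> p) [0..<n])"
          by (rule val[symmetric, OF that(2) permutes_compose[OF p(1) i]])
        finally show ?thesis using p by (simp add: tensor_act_def)
      next
        case False
        then have "map (?i \<sigma>) js \<notin> multi_indices n r \<or> \<not> distinct (map (?i \<sigma>) js)"
          using multi_indices_map[OF i] by (auto simp: distinct_map)
        then show ?thesis using False outside by (simp add: tensor_act_def)
      qed
    qed
  qed
qed

text \<open>By equivariance and the support condition, \<open>\<phi>\<close> is determined by its coefficient at \<open>[0..<n]\<close>.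
  That functional factors through deletion of the first row, since it vanishes on the kernel; so it is
  a combination of the coordinate functionals \<open>f b\<close>, with its values at the lifts \<open>z b\<close> as coefficients.
  Together with \<open>induced_hom_in_mult_space\<close> this identifies the multiplicity space with the dual of
  the Specht module of \<open>mu\<close>.\<close>

lemma mult_space_decomposition:
  fixes l :: nat and mu :: "nat list"
  defines "n \<equiv> sum_list mu"
  assumes part: "partition_of r (l # mu)" and m: "\<phi> \<in> mult_space n r (l # mu)"
    and fin: "finite B"
    and f_sum: "\<And>y. y \<in> specht mu \<Longrightarrow> (\<Sum>b\<in>B. fscale (f b y) b) = y"
    and z: "\<And>b. b \<in> B \<Longrightarrow> z b \<in> specht (l # mu)" "\<And>b. b \<in> B \<Longrightarrow> drop_first_row {n..<r} (z b) = b"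
  shows "\<phi> = (\<Sum>b\<in>B. hscale (\<phi> (z b) [0..<n]) (induced_hom n r (l # mu) (f b)))"
proof (intro ext)
  fix v js
  let ?S = "specht (l # mu)" and ?js0 = "[0..<n]"
  have r: "r = l + n" "sum_list (l # mu) = r" using part by (auto simp: partition_of_def n_def)
  have rhs: "(\<Sum>b\<in>B. hscale (\<phi> (z b) ?js0) (induced_hom n r (l # mu) (f b))) v js =
      (\<Sum>b\<in>B. \<phi> (z b) ?js0 * induced_hom n r (l # mu) (f b) v js)"
    by (simp add: sum_fun_apply hscale_def fscale_def)
  show "\<phi> v js = (\<Sum>b\<in>B. hscale (\<phi> (z b) ?js0) (induced_hom n r (l # mu) (f b))) v js"
  proof (cases "v \<in> ?S \<and> js \<in> multi_indices n r \<and> distinct js")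
    case False
    then have "\<phi> v js = 0" using mult_space_support[OF part] m unfolding n_def by blast
    moreover have "induced_hom n r (l # mu) (f b) v js = 0" for b
      unfolding induced_hom_def using False by auto
    ultimately show ?thesis unfolding rhs by simp
  next
    case True
    then obtain p where p: "p permutes {..<r}" "js = map p ?js0"
      using exists_permutes_map_upt by metis
    \<comment> \<open>Move the evaluation from \<open>js\<close> back to \<open>[0..<n]\<close>.\<close>
    define w where "w = tabloid_act (Hilbert_Choice.inv p) v"
    have w: "w \<in> ?S" unfolding w_def
      using tabloid_act_specht[of _ "l # mu" v] True permutes_inv[OF p(1)] r by simp
    define c where "c b = f b (drop_first_row {n..<r} w)" for b
    \<comment> \<open>The combination of the lifts with the same image as \<open>w\<close>.\<close>
    let ?u = "\<Sum>b\<in>B. fscale (c b) (z b)"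
    have cz: "fscale (c b) (z b) \<in> ?S" if "b \<in> B" for b
      by (rule fun_vs.subspace_scale[OF subspace_specht z(1)[OF that]])
    have u: "?u \<in> ?S" by (rule fun_vs.subspace_sum[OF subspace_specht cz])
    have "drop_first_row {n..<r} ?u = (\<Sum>b\<in>B. fscale (c b) b)"
      unfolding drop_first_row_sum drop_first_row_fscale by (intro sum.cong refl) (simp add: z(2))
    also have "\<dots> = drop_first_row {n..<r} w"
      unfolding c_def using drop_first_row_specht[OF w] r by (intro f_sum) (simp add: n_def)
    finally have "drop_first_row {n..<r} (w - ?u) = 0" by (simp only: drop_first_row_diff diff_self)
    moreover have wu: "w - ?u \<in> ?S" by (rule fun_vs.subspace_diff[OF subspace_specht w u])
    ultimately have "\<phi> (w - ?u) ?js0 = 0"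
      using mult_space_eval_0_if_drop_first_row_eq_0[OF part] m unfolding n_def by blast
    moreover have "\<phi> w = \<phi> (w - ?u) + \<phi> ?u"
      using mult_space_add[OF m wu u] by simp
    ultimately have "\<phi> w ?js0 = \<phi> ?u ?js0" by simp
    also have "\<phi> ?u = (\<Sum>b\<in>B. \<phi> (fscale (c b) (z b)))" by (rule mult_space_sum[OF m fin cz])
    also have "\<dots> ?js0 = (\<Sum>b\<in>B. \<phi> (z b) ?js0 * c b)"
      unfolding sum_fun_apply
      by (intro sum.cong refl, subst mult_space_fscale[OF m z(1)]) (simp_all add: fscale_def)
    finally have "\<phi> w ?js0 = (\<Sum>b\<in>B. \<phi> (z b) ?js0 * c b)" .
    moreover have "c b = induced_hom n r (l # mu) (f b) v js" for b
      unfolding c_def w_def p(2) n_def using True p(1) by (intro induced_hom_map[OF part, symmetric]) auto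
    moreover have "\<phi> w ?js0 = \<phi> v js"
      unfolding w_def p(2) using True by (intro mult_space_eval_map[OF m p(1), symmetric]) auto
    ultimately show ?thesis unfolding rhs by simp
  qed
qed

lemma coordinate_hom_in_mult_space:
  assumes part: "partition_of r (l # mu)"
    and B: "fun_vs.independent B" "fun_vs.span B = specht mu"
  shows "induced_hom (sum_list mu) r (l # mu) (\<lambda>y. fun_vs.representation B y b) \<in>
    mult_space (sum_list mu) r (l # mu)"
proof (rule induced_hom_in_mult_space[OF part])
  let ?f = "\<lambda>y. fun_vs.representation B y b"
  show "?f (x + y) = ?f x + ?f y" if "x \<in> specht mu" "y \<in> specht mu" for x y
    using fun_vs.representation_add[OF B(1), of y x] that B(2) by simp
  show "?f (fscale c x) = c * ?f x" if "x \<in> specht mu" for c x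
    using fun_vs.representation_scale[OF B(1), of x c] that B(2) by simp
qed

lemma pa_char_eq_sum:
  fixes l :: nat and mu :: "nat list"
  defines "n \<equiv> sum_list mu"
  assumes part: "partition_of r (l # mu)"
    and B: "fun_vs.independent B" "fun_vs.span B = specht mu" "finite B"
    and z: "\<And>b. b \<in> B \<Longrightarrow> z b \<in> specht (l # mu)" "\<And>b. b \<in> B \<Longrightarrow> drop_first_row {n..<r} (z b) = b"
  shows "pa_char n r (l # mu) x = (\<Sum>b\<in>B. pa_act n r x
    (induced_hom n r (l # mu) (\<lambda>y. fun_vs.representation B y b) (z b)) [0..<n])"
  unfolding pa_char_def
proof (rule hom_vs.trace_on_eq_sum_coordinates[where l = "\<lambda>b \<phi>. \<phi> (z b) [0..<n]"])
  let ?f = "\<lambda>b y. fun_vs.representation B y b"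
  show "hom_vs.subspace (mult_space n r (l # mu))" by (rule subspace_mult_space)
  show "finite B" by (rule B(3))
  show "induced_hom n r (l # mu) (?f b) \<in> mult_space n r (l # mu)" for b
    unfolding n_def by (rule coordinate_hom_in_mult_space[OF part B(1,2)])
  show "\<phi> = (\<Sum>b\<in>B. hscale (\<phi> (z b) [0..<n]) (induced_hom n r (l # mu) (?f b)))"
    if "\<phi> \<in> mult_space n r (l # mu)" for \<phi>
    unfolding n_def
  proof (rule mult_space_decomposition[OF part _ B(3)])
    show "(\<Sum>b\<in>B. fscale (?f b y) b) = y" if "y \<in> specht mu" for y
      using fun_vs.sum_representation_eq[OF B(1) _ B(3) order_refl] that B(2) by simp
  qed (use that z in \<open>simp_all add: n_def\<close>)
  show "(\<lambda>v. pa_act n r x (\<phi> v)) \<in> mult_space n r (l # mu)"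
    if "\<phi> \<in> mult_space n r (l # mu)" for \<phi>
    by (rule mult_space_closed[OF that])
  show "(\<lambda>v. pa_act n r x ((\<phi> + \<psi>) v)) = (\<lambda>v. pa_act n r x (\<phi> v)) + (\<lambda>v. pa_act n r x (\<psi> v))" for \<phi> \<psi>
    by (rule ext) (simp only: plus_fun_apply pa_act_add)
  show "(\<lambda>v. pa_act n r x (hscale c \<phi> v)) = hscale c (\<lambda>v. pa_act n r x (\<phi> v))" for c \<phi>
    by (simp only: hscale_def pa_act_fscale)
qed (simp_all add: hscale_def fscale_def)

section \<open>Diagrams acting on the multiplicity space\<close>

lemma pa_act_diagram_elt:
  assumes "d \<in> diagrams n"
  shows "pa_act n r (diagram_elt d) w = diagram_act n r d w"
proof
  fix js
  have "pa_act n r (diagram_elt d) w js =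
      (\<Sum>e\<in>diagrams n. if e = d then diagram_act n r e w js else 0)"
    unfolding pa_act_def diagram_elt_def by (intro sum.cong) auto
  then show "pa_act n r (diagram_elt d) w js = diagram_act n r d w js"
    using assms finite_diagrams by simp
qed

definition perm_diagram :: "nat \<Rightarrow> (nat \<Rightarrow> nat) \<Rightarrow> diagram" where
  "perm_diagram n \<sigma> = (\<lambda>i. {Inl i, Inr (\<sigma> i)}) ` {..<n}"

lemma perm_diagram_in_diagrams:
  assumes \<sigma>: "\<sigma> permutes {..<n}"
  shows "perm_diagram n \<sigma> \<in> diagrams n"
  unfolding diagrams_def mem_Collect_eq
proof (rule partition_onI)
  have "\<Union> (perm_diagram n \<sigma>) = Inl ` {..<n} \<union> Inr ` \<sigma> ` {..<n}" by (auto simp: perm_diagram_def)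
  also have "\<sigma> ` {..<n} = {..<n}" by (rule permutes_image[OF \<sigma>])
  finally show "\<Union> (perm_diagram n \<sigma>) = {..<n} <+> {..<n}" by (simp add: Plus_def)
  show "disjnt p q" if "p \<in> perm_diagram n \<sigma>" "q \<in> perm_diagram n \<sigma>" "p \<noteq> q" for p q
    using that by (auto simp: perm_diagram_def disjnt_def inj_eq[OF permutes_inj[OF \<sigma>]])
qed (auto simp: perm_diagram_def)

lemma delta_perm_diagram:
  "delta (perm_diagram n \<sigma>) js ks \<longleftrightarrow> (\<forall>i<n. js ! i = ks ! \<sigma> i)"
  by (auto simp: delta_def perm_diagram_def)

lemma diagram_act_perm_diagram:
  assumes \<sigma>: "\<sigma> permutes {..<n}" and js: "js \<in> multi_indices n r"
  shows "diagram_act n r (perm_diagram n \<sigma>) w js = w (map (\<lambda>i. js ! Hilbert_Choice.inv \<sigma> i) [0..<n])"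
proof -
  let ?ks = "map (\<lambda>i. js ! Hilbert_Choice.inv \<sigma> i) [0..<n]"
  have lt: "\<sigma> i < n \<longleftrightarrow> i < n" "Hilbert_Choice.inv \<sigma> i < n \<longleftrightarrow> i < n" for i
    using permutes_in_image[OF \<sigma>, of i] permutes_in_image[OF permutes_inv[OF \<sigma>], of i] by auto
  have len: "length js = n" using js by (simp add: multi_indices_def)
  have "?ks \<in> multi_indices n r"
    using js lt by (auto simp: multi_indices_def subset_iff)
  moreover have "delta (perm_diagram n \<sigma>) js ks \<longleftrightarrow> ks = ?ks" if "ks \<in> multi_indices n r" for ks
  proof -
    have "length ks = n" using that by (simp add: multi_indices_def)
    then have "ks = ?ks \<longleftrightarrow> (\<forall>i<n. ks ! i = js ! Hilbert_Choice.inv \<sigma> i)"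
      by (auto simp: list_eq_iff_nth_eq)
    also have "\<dots> \<longleftrightarrow> (\<forall>i<n. js ! i = ks ! \<sigma> i)"
      using lt permutes_inverses[OF \<sigma>] by metis
    finally show ?thesis by (simp add: delta_perm_diagram)
  qed
  ultimately have "(\<Sum>ks\<in>multi_indices n r. of_bool (delta (perm_diagram n \<sigma>) js ks) * w ks) =
      (\<Sum>ks\<in>multi_indices n r. if ks = ?ks then w ks else 0)"
    by (intro sum.cong) auto
  then show ?thesis using js \<open>?ks \<in> multi_indices n r\<close> finite_multi_indices
    by (simp add: diagram_act_def)
qed

text \<open>The basis is the one that occurs in the definition of the character, so that the character is
  literally the sum of the diagonal coordinates.\<close>

lemma specht_basis_with_lifts:
  obtains B z where "fun_vs.independent B" "fun_vs.span B = specht mu" "finite B"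
    and "\<And>b. b \<in> B \<Longrightarrow> z b \<in> specht (l # mu)"
    and "\<And>b. b \<in> B \<Longrightarrow> drop_first_row {sum_list mu..<l + sum_list mu} (z b) = b"
    and "\<And>\<sigma>. sym_char mu \<sigma> = (\<Sum>b\<in>B. fun_vs.representation B (tabloid_act \<sigma> b) b)"
proof -
  define B where "B = (SOME B. fun_vs.independent B \<and> fun_vs.span B = specht mu)"
  obtain B0 where "B0 \<subseteq> specht mu" "fun_vs.independent B0" "specht mu \<subseteq> fun_vs.span B0"
    using fun_vs.maximal_independent_subset by blast
  then have "\<exists>B. fun_vs.independent B \<and> fun_vs.span B = specht mu"
    using fun_vs.span_minimal[OF _ subspace_specht] by blast
  then have "fun_vs.independent B \<and> fun_vs.span B = specht mu"
    unfolding B_def by (rule someI_ex)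
  then have B: "fun_vs.independent B" "fun_vs.span B = specht mu" by auto
  obtain G where "finite G" "specht mu = fun_vs.span G" using specht_finite_span by blast
  then have fin: "finite B"
    using fun_vs.independent_span_bound[OF _ B(1), of G] B(2) fun_vs.span_superset[of B] by simp
  have "\<forall>b\<in>B. \<exists>x. x \<in> specht (l # mu) \<and>
      drop_first_row {sum_list mu..<l + sum_list mu} x = b"
    using drop_first_row_surj[of _ mu l] B(2) fun_vs.span_superset[of B] by blast
  then obtain z where "\<forall>b\<in>B. z b \<in> specht (l # mu) \<and>
      drop_first_row {sum_list mu..<l + sum_list mu} (z b) = b"
    by (rule bchoice[THEN exE])
  moreover have "sym_char mu \<sigma> = (\<Sum>b\<in>B. fun_vs.representation B (tabloid_act \<sigma> b) b)" for \<sigma>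
    unfolding sym_char_def fun_vs.trace_on_def Let_def B_def[symmetric] ..
  ultimately show thesis by (intro that[OF B fin]) auto
qed

text \<open>The diagram of \<open>\<sigma>\<close> acts on the functional at \<open>[0..<n]\<close> by moving the evaluation to
  \<open>map (inv \<sigma>) [0..<n]\<close>, which by equivariance is the same as applying \<open>\<sigma>\<close> to the argument.  On the dual
  of the Specht module of \<open>mu\<close> this is the transpose of the action of \<open>\<sigma>\<close>, and it has the same trace.\<close>

lemma pa_char_perm_diagram:
  assumes part: "partition_of r (l # mu)" and \<sigma>: "\<sigma> permutes {..<sum_list mu}"
  shows "pa_char (sum_list mu) r (l # mu) (diagram_elt (perm_diagram (sum_list mu) \<sigma>)) = sym_char mu \<sigma>"
proof -
  define n where "n = sum_list mu"
  have r: "r = l + n" using part by (simp add: partition_of_def n_def)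
  note \<sigma> = \<sigma>[folded n_def]
  obtain B z where B: "fun_vs.independent B" "fun_vs.span B = specht mu" "finite B"
    and z1: "\<And>b. b \<in> B \<Longrightarrow> z b \<in> specht (l # mu)"
    and z2: "\<And>b. b \<in> B \<Longrightarrow> drop_first_row {sum_list mu..<l + sum_list mu} (z b) = b"
    and char: "\<And>\<sigma>. sym_char mu \<sigma> = (\<Sum>b\<in>B. fun_vs.representation B (tabloid_act \<sigma> b) b)"
    using specht_basis_with_lifts[of mu l] by blast
  note z = z1 z2[folded n_def, folded r]
  have \<sigma>r: "\<sigma> permutes {..<r}" by (rule permutes_subset[OF \<sigma>]) (simp add: r)
  have js0: "[0..<n] \<in> multi_indices n r" using r by (auto simp: multi_indices_def)
  let ?i = "Hilbert_Choice.inv \<sigma>" and ?d = "perm_diagram n \<sigma>"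
  have inv_map: "map (\<lambda>i. [0..<n] ! ?i i) [0..<n] = map ?i [0..<n]"
    using permutes_in_image[OF permutes_inv[OF \<sigma>]] by (intro map_cong refl) simp
  have "pa_char n r (l # mu) (diagram_elt ?d) = (\<Sum>b\<in>B. pa_act n r (diagram_elt ?d)
      (induced_hom n r (l # mu) (\<lambda>y. fun_vs.representation B y b) (z b)) [0..<n])"
    unfolding n_def by (rule pa_char_eq_sum[OF part B]) (use z in \<open>simp_all add: n_def\<close>)
  also have "\<dots> = (\<Sum>b\<in>B. fun_vs.representation B (tabloid_act \<sigma> b) b)"
  proof (rule sum.cong[OF refl])
    fix b assume b: "b \<in> B"
    let ?h = "induced_hom n r (l # mu) (\<lambda>y. fun_vs.representation B y b) (z b)"
    have "pa_act n r (diagram_elt ?d) ?h [0..<n] = ?h (map ?i [0..<n])"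
      by (simp only: pa_act_diagram_elt[OF perm_diagram_in_diagrams[OF \<sigma>]]
          diagram_act_perm_diagram[OF \<sigma> js0] inv_map)
    also have "\<dots> = fun_vs.representation B
        (drop_first_row {n..<r} (tabloid_act (Hilbert_Choice.inv ?i) (z b))) b"
      unfolding n_def by (rule induced_hom_map[OF part z(1)[OF b] permutes_inv[OF \<sigma>r]])
    also have "drop_first_row {n..<r} (tabloid_act (Hilbert_Choice.inv ?i) (z b)) = tabloid_act \<sigma> b"
      by (simp add: permutes_inv_inv[OF \<sigma>] drop_first_row_lower_act[OF \<sigma>] z(2)[OF b])
    finally show "pa_act n r (diagram_elt ?d) ?h [0..<n] = fun_vs.representation B (tabloid_act \<sigma> b) b" .
  qed
  also have "\<dots> = sym_char mu \<sigma>"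
    by (rule char[symmetric])
  finally show ?thesis by (simp add: n_def)
qed

text \<open>Such a diagram annihilates the multiplicity space.  A coefficient of \<open>d \<cdot> w\<close> at \<open>js\<close> is zero unless
  \<open>js\<close> is constant on the upper vertices of each block.  Then the propagating blocks see fewer than \<open>n\<close>
  values of \<open>js\<close>, so more than \<open>r - n\<close> values remain.  Transposing two of these in \<open>js\<close> affects only blocks
  consisting of upper vertices, and there it preserves all equalities between entries; so the
  coefficient does not change, and pigeonhole shows that it vanishes.\<close>

lemma pa_char_eq_0_if_propagation_number_less:
  assumes part: "partition_of r (l # mu)" and d: "d \<in> diagrams (sum_list mu)"
    and less: "propagation_number d < sum_list mu"
  shows "pa_char (sum_list mu) r (l # mu) (diagram_elt d) = 0"
proof -
  define n where "n = sum_list mu"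
  have r: "r = l + n" using part by (simp add: partition_of_def n_def)
  note d = d[folded n_def] and less = less[folded n_def]
  let ?M = "mult_space n r (l # mu)" and ?S = "specht (l # mu)"
  let ?F = "\<lambda>\<phi> v. pa_act n r (diagram_elt d) (\<phi> v)"
  have P: "partition_on ({..<n} <+> {..<n}) d" using d by (simp add: diagrams_def)
  have vanish: "?F \<phi> v js = 0" if m: "\<phi> \<in> ?M" and v: "v \<in> ?S" for \<phi> v js
  proof -
    have F: "?F \<phi> \<in> ?M" by (rule mult_space_closed[OF m])
    define up where "up B = {i. Inl i \<in> B}" for B :: "(nat + nat) set"
    have up_lt: "i < n" if "B \<in> d" "i \<in> up B" for B i
    proof -
      have "Inl i \<in> {..<n} <+> {..<n}" unfolding partition_onD1[OF P] using that by (auto simp: up_def)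
      then show ?thesis by auto
    qed
    show ?thesis
    proof (cases "js \<in> multi_indices n r \<and> (\<forall>B\<in>d. \<forall>i\<in>up B. \<forall>j\<in>up B. js ! i = js ! j)")
      case False
      have "\<not> delta d js ks" if "B \<in> d" "i \<in> up B" "j \<in> up B" "js ! i \<noteq> js ! j" for B i j ks
      proof
        assume "delta d js ks"
        then have "case_sum ((!) js) ((!) ks) (Inl i) = case_sum ((!) js) ((!) ks) (Inl j)"
          using that unfolding delta_def up_def by blast
        then show False using that by simp
      qed
      then have "\<not> delta d js ks" if "js \<in> multi_indices n r" for ks using False that by blast
      then show ?thesis
        unfolding pa_act_diagram_elt[OF d] diagram_act_def by simp
    next
      case True
      \<comment> \<open>The values of \<open>js\<close> at the upper vertices of propagating blocks, read off from one vertex per block.\<close>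
      define Y where "Y = (\<lambda>B. js ! (SOME i. i \<in> up B)) ` propagating d"
      have Y: "js ! i \<in> Y" if "B \<in> propagating d" "i \<in> up B" for B i
      proof -
        have "(SOME i. i \<in> up B) \<in> up B" using that(2) by (rule someI)
        then have "js ! i = js ! (SOME i. i \<in> up B)"
          using True that unfolding propagating_def by blast
        then show ?thesis using that(1) unfolding Y_def by blast
      qed
      have "finite d" using P finite_elements[OF _ P] by simp
      then have fin: "finite (propagating d)" by (simp add: propagating_def)
      have cardY: "card Y < n"
        using card_image_le[OF fin, of "\<lambda>B. js ! (SOME i. i \<in> up B)"] less
        by (simp add: Y_def propagation_number_def)
      have len: "length js = n" using True by (simp add: multi_indices_def)
      show ?thesis
      proof (rule eval_0_if_swaps_fix[OF part F _ _ _ v, where X = "{..<r} - Y"])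
        have "card {..<r} - card Y \<le> card ({..<r} - Y)"
          using fin by (intro diff_card_le_card_Diff) (simp add: Y_def)
        then show "card ({..<r} - Y) > l" using cardY r by simp
      next
        fix a b w assume ab: "a \<in> {..<r} - Y" "b \<in> {..<r} - Y"
        let ?t = "transpose a b"
        have t: "?t permutes {..<r}" using ab by (intro permutes_swap_id) auto
        have "delta d (map ?t js) ks \<longleftrightarrow> delta d js ks" for ks
        proof -
          have "(\<forall>x\<in>B. \<forall>y\<in>B. case_sum ((!) (map ?t js)) ((!) ks) x = case_sum ((!) (map ?t js)) ((!) ks) y) \<longleftrightarrow>
              (\<forall>x\<in>B. \<forall>y\<in>B. case_sum ((!) js) ((!) ks) x = case_sum ((!) js) ((!) ks) y)"
            if B: "B \<in> d" for B
          proof (cases "B \<in> propagating d")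
            case True
            have "?t (js ! i) = js ! i" if "Inl i \<in> B" for i
              using Y[OF True, of i] that ab by (auto simp: up_def transpose_def)
            then have "case_sum ((!) (map ?t js)) ((!) ks) x = case_sum ((!) js) ((!) ks) x" if "x \<in> B" for x
              using that up_lt[OF B] len by (cases x) (auto simp: up_def)
            then show ?thesis by simp
          next
            case False
            show ?thesis
            proof (cases "\<exists>i. Inl i \<in> B")
              case True
              then have "\<exists>i. x = Inl i \<and> i < n" if "x \<in> B" for x
                using that False B up_lt[OF B] by (cases x) (auto simp: propagating_def up_def)
              then have "case_sum ((!) (map ?t js)) ((!) ks) x = ?t (case_sum ((!) js) ((!) ks) x)" if "x \<in> B" for x
                using that len by fastforce
              then show ?thesis using inj_eq[OF permutes_inj[OF t]] by simp
            next
              case False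
              then have "case_sum ((!) (map ?t js)) ((!) ks) x = case_sum ((!) js) ((!) ks) x" if "x \<in> B" for x
                using that by (cases x) auto
              then show ?thesis by simp
            qed
          qed
          then show ?thesis unfolding delta_def by (rule ball_cong[OF refl])
        qed
        then show "?F \<phi> w (map ?t js) = ?F \<phi> w js"
          unfolding pa_act_diagram_elt[OF d] diagram_act_def by (simp add: multi_indices_map[OF t])
      qed blast
    qed
  qed
  show ?thesis
  proof (rule specht_basis_with_lifts[of mu l])
    fix B z
    assume B: "fun_vs.independent B" "fun_vs.span B = specht mu" "finite B"
      and z1: "\<And>b. b \<in> B \<Longrightarrow> z b \<in> ?S"
      and z2: "\<And>b. b \<in> B \<Longrightarrow> drop_first_row {sum_list mu..<l + sum_list mu} (z b) = b"
    note z = z1 z2[folded n_def, folded r]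
    have "pa_act n r (diagram_elt d)
        (induced_hom n r (l # mu) (\<lambda>y. fun_vs.representation B y b) (z b)) js = 0"
      if "b \<in> B" for b js
      unfolding n_def
      by (rule vanish[unfolded n_def, OF coordinate_hom_in_mult_space[OF part B(1,2)] z1[OF that]])
    then have "(\<Sum>b\<in>B. pa_act n r (diagram_elt d)
        (induced_hom n r (l # mu) (\<lambda>y. fun_vs.representation B y b) (z b)) [0..<n]) = 0"
      by (intro sum.neutral) blast
    moreover have "pa_char n r (l # mu) (diagram_elt d) = (\<Sum>b\<in>B. pa_act n r (diagram_elt d)
        (induced_hom n r (l # mu) (\<lambda>y. fun_vs.representation B y b) (z b)) [0..<n])"
      unfolding n_def by (rule pa_char_eq_sum[OF part B]) (use z in \<open>simp_all add: n_def\<close>)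
    ultimately show ?thesis by (simp add: n_def)
  qed
qed

section \<open>Permutation diagrams and the theorem\<close>

lemma partition_on_same_block:
  assumes "partition_on A d" "B \<in> d" "C \<in> d" "x \<in> B" "x \<in> C"
  shows "B = C"
  using assms partition_onD2[OF assms(1)] by (auto simp: disjoint_def)

lemma inj_on_choice_of_partition:
  assumes "partition_on A d" "Q \<subseteq> d" "\<And>B. B \<in> Q \<Longrightarrow> g (u B) \<in> B"
  shows "inj_on u Q"
proof (rule inj_onI)
  fix B C assume "B \<in> Q" "C \<in> Q" "u B = u C"
  then show "B = C"
    using assms(2) partition_on_same_block[OF assms(1), of B C "g (u B)"] assms(3)[of B] assms(3)[of C] by auto
qed

text \<open>Choosing an upper vertex in each propagating block is injective, and there are at least \<open>n\<close> such
  blocks; so every upper vertex is chosen, and no block contains two of them.  The same holds for the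
  lower vertices.\<close>

lemma full_propagation_imp_perm_diagram:
  assumes d: "d \<in> diagrams n" and ge: "propagation_number d \<ge> n"
  shows "\<exists>\<sigma>. \<sigma> permutes {..<n} \<and> d = perm_diagram n \<sigma>"
proof -
  have P: "partition_on ({..<n} <+> {..<n}) d" using d by (simp add: diagrams_def)
  have Un: "\<Union>d = {..<n} <+> {..<n}" using partition_onD1[OF P] by simp
  have Inl_lt: "i < n" if "B \<in> d" "Inl i \<in> B" for B i
  proof -
    have "Inl i \<in> {..<n} <+> {..<n}" unfolding Un[symmetric] using that by blast
    then show ?thesis by auto
  qed
  have Inr_lt: "i < n" if "B \<in> d" "Inr i \<in> B" for B i
  proof -
    have "Inr i \<in> {..<n} <+> {..<n}" unfolding Un[symmetric] using that by blast
    then show ?thesis by auto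
  qed
  define Q where "Q = propagating d"
  have Qd: "Q \<subseteq> d" by (auto simp: Q_def propagating_def)
  have "finite d" using finite_elements[OF _ P] by simp
  then have finQ: "finite Q" using Qd finite_subset by blast
  have bij: "bij_betw u Q {..<n}"
    if u: "\<And>B. B \<in> Q \<Longrightarrow> g (u B) \<in> B" "\<And>B. B \<in> Q \<Longrightarrow> u B < n"
    for u and g :: "nat \<Rightarrow> nat + nat"
  proof -
    have inj: "inj_on u Q" using inj_on_choice_of_partition[OF P Qd, of g u] u(1) by blast
    have "card (u ` Q) \<ge> n" using ge card_image[OF inj] by (simp add: Q_def propagation_number_def)
    then have "u ` Q = {..<n}" using u(2) by (intro card_seteq) auto
    then show ?thesis using inj by (simp add: bij_betw_def)
  qed
  have "\<forall>B\<in>Q. \<exists>i. Inl i \<in> B" by (auto simp: Q_def propagating_def)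
  then obtain u where u: "\<And>B. B \<in> Q \<Longrightarrow> Inl (u B) \<in> B" by metis
  have "\<forall>B\<in>Q. \<exists>i. Inr i \<in> B" by (auto simp: Q_def propagating_def)
  then obtain v where v: "\<And>B. B \<in> Q \<Longrightarrow> Inr (v B) \<in> B" by metis
  have bu: "bij_betw u Q {..<n}" by (rule bij[of Inl]) (use u Inl_lt Qd in blast)+
  have bv: "bij_betw v Q {..<n}" by (rule bij[of Inr]) (use v Inr_lt Qd in blast)+
  have block: "B \<in> Q \<and> (x = Inl (u B) \<or> x = Inr (v B))" if B: "B \<in> d" "x \<in> B" for B x
  proof (cases x)
    case (Inl i)
    then have "i \<in> u ` Q" using Inl_lt B bu by (auto simp: bij_betw_def)
    then obtain C where C: "C \<in> Q" "i = u C" by blast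
    then have "B = C" using partition_on_same_block[OF P B(1) _ B(2), of C] u Qd Inl by blast
    then show ?thesis using C Inl by simp
  next
    case (Inr i)
    then have "i \<in> v ` Q" using Inr_lt B bv by (auto simp: bij_betw_def)
    then obtain C where C: "C \<in> Q" "i = v C" by blast
    then have "B = C" using partition_on_same_block[OF P B(1) _ B(2), of C] v Qd Inr by blast
    then show ?thesis using C Inr by simp
  qed
  have "B \<noteq> {}" if "B \<in> d" for B using partition_onD3[OF P] that by blast
  then have dQ: "d = Q" using block Qd by blast
  have B: "B = {Inl (u B), Inr (v B)}" if "B \<in> Q" for B
    using block[of B] u[OF that] v[OF that] that Qd by blast
  let ?w = "inv_into Q u"
  define \<sigma> where "\<sigma> = (\<lambda>i. if i < n then v (?w i) else i)"
  have bw: "bij_betw ?w {..<n} Q" by (rule bij_betw_inv_into[OF bu])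
  have "bij_betw (v \<circ> ?w) {..<n} {..<n}" by (rule bij_betw_trans[OF bw bv])
  then have "bij_betw \<sigma> {..<n} {..<n}"
    by (subst bij_betw_cong[of _ _ "v \<circ> ?w"]) (simp_all add: \<sigma>_def)
  then have "\<sigma> permutes {..<n}" by (rule bij_imp_permutes) (simp add: \<sigma>_def)
  moreover have "d = perm_diagram n \<sigma>"
  proof -
    have "d = (\<lambda>B. {Inl (u B), Inr (v B)}) ` Q" using B by (auto simp: dQ image_iff)
    also have "Q = ?w ` {..<n}" using bw by (simp add: bij_betw_def)
    also have "(\<lambda>B. {Inl (u B), Inr (v B)}) ` ?w ` {..<n} = perm_diagram n \<sigma>"
      unfolding perm_diagram_def image_image
      by (intro image_cong refl) (use bij_betw_inv_into_right[OF bu] in \<open>simp add: \<sigma>_def\<close>)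
    finally show ?thesis .
  qed
  ultimately show ?thesis by blast
qed

lemma inj_on_perm_diagram: "inj_on (perm_diagram n) {\<sigma>. \<sigma> permutes {..<n}}"
proof (rule inj_onI, unfold mem_Collect_eq, rule ext)
  fix \<sigma> \<tau> i assume p: "\<sigma> permutes {..<n}" "\<tau> permutes {..<n}" and eq: "perm_diagram n \<sigma> = perm_diagram n \<tau>"
  show "\<sigma> i = \<tau> i"
  proof (cases "i < n")
    case True
    then have "{Inl i, Inr (\<sigma> i)} \<in> perm_diagram n \<tau>" unfolding eq[symmetric] by (auto simp: perm_diagram_def)
    then show ?thesis by (auto simp: perm_diagram_def doubleton_eq_iff)
  next
    case False
    then show ?thesis using permutes_not_in[OF p(1)] permutes_not_in[OF p(2)] by simp
  qed
qed

lemma diagram_prod_perm_diagram: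
  assumes "n > 0"
  shows "diagram_prod A (perm_diagram n \<sigma>) = (\<Prod>i<n. A $$ (i, \<sigma> i))"
proof -
  let ?b = "\<lambda>i. {Inl i, Inr (\<sigma> i)} :: (nat + nat) set"
  have inj: "inj_on ?b {..<n}" by (auto simp: inj_on_def doubleton_eq_iff)
  have all_prop: "propagating (perm_diagram n \<sigma>) = ?b ` {..<n}"
    by (auto simp: propagating_def perm_diagram_def)
  then have "propagation_number (perm_diagram n \<sigma>) = n"
    by (simp add: propagation_number_def card_image[OF inj])
  moreover have "{(i, j). Inl i \<in> ?b k \<and> Inr j \<in> ?b k} = {(k, \<sigma> k)}" for k by auto
  ultimately show ?thesis
    using assms by (simp add: diagram_prod_def all_prop prod.reindex[OF inj])
qed

theorem theorem1:
  fixes n r :: nat and A :: "complex mat" and lam :: "nat list"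
  assumes "n > 0" and "r > 0"
    and "A \<in> carrier_mat n n"
    and "partition_of r lam"
    and "sum_list (tl lam) = n"
  shows "recombinant n r lam A = immanant n (tl lam) A"
proof -
  obtain l mu where lam: "lam = l # mu"
    using assms(1,5) by (cases lam) auto
  have part: "partition_of r (l # mu)" and n: "n = sum_list mu" using assms lam by auto
  let ?f = "\<lambda>d. pa_char n r lam (diagram_elt d) * diagram_prod A d"
  let ?P = "{\<sigma>. \<sigma> permutes {..<n}}"
  have "recombinant n r lam A = sum ?f (diagrams n)" by (simp add: recombinant_def)
  also have "\<dots> = sum ?f (perm_diagram n ` ?P)"
  proof (rule sum.mono_neutral_right[OF finite_diagrams])
    show "perm_diagram n ` ?P \<subseteq> diagrams n" using perm_diagram_in_diagrams by blast
    show "\<forall>d\<in>diagrams n - perm_diagram n ` ?P. ?f d = 0"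
    proof
      fix d assume d: "d \<in> diagrams n - perm_diagram n ` ?P"
      then have "\<not> n \<le> propagation_number d"
        using full_propagation_imp_perm_diagram[of d n] by blast
      then show "?f d = 0"
        using pa_char_eq_0_if_propagation_number_less[OF part, of d] d by (simp add: lam n not_le)
    qed
  qed
  also have "\<dots> = (\<Sum>\<sigma>\<in>?P. ?f (perm_diagram n \<sigma>))"
    by (simp add: sum.reindex[OF inj_on_perm_diagram])
  also have "\<dots> = (\<Sum>\<sigma>\<in>?P. sym_char mu \<sigma> * (\<Prod>i<n. A $$ (i, \<sigma> i)))"
    using pa_char_perm_diagram[OF part] diagram_prod_perm_diagram[OF assms(1), of A]
    by (intro sum.cong refl) (simp add: lam n)
  also have "\<dots> = immanant n (tl lam) A" by (simp add: immanant_def lam)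
  finally show ?thesis .
qed

end
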